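(* Let $d=1$, $p>1$ and $q\ge0$. Then the solution $u_{c,\infty}$ of the problem $$(|u'|^{p-2}u')'=u^q\quad (0<r<\infty),\qquad \lim_{r\to0^+}u(r)=1,\quad \lim_{r\to\infty}u(r)=0$$ has the following closed form: (i) if $q=p-1$: $u_{c,\infty}(r)=e^{-(p-1)^{-1/p}\,r}$; (ii) if $q<p-1$: $u_{c,\infty}(r)=\left(1-\frac rR\right)_+^{\frac{p}{p-q-1}}$ for $r>0$, where $R=\dfrac{(p-1)^{1/p}(q+1)^{1/p}}{p^{1/p-1}(p-q-1)}$; (iii) if $q>p-1$: $u_{c,\infty}(r)=\left(1+\dfrac{p^{1/p-1}(q+1-p)}{(p-1)^{1/p}(q+1)^{1/p}}\,r\right)^{-\frac{p}{q+1-p}}$ for $r>0$. Moreover, the best constant is $$C_{q,\infty,p}=\left(\frac{p+(p-1)(q+1)}{2p}\right)^{\frac{p}{p+(p-1)(q+1)}}.$$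
   Context: A solution is a non-negative, non-increasing $C^1$ function on $(0,\infty)$ satisfying the equation in the distribution sense; $u^q$ is understood to be $0$ where $u=0$ (relevant only for $q=0$). $C_{q,\infty,p}$ is the smallest constant $C$ such that, with $\theta=\frac{p}{p+(p-1)(q+1)}$, $$\|u\|_{L^\infty(\mathbb{R})}\le C\,\|u\|_{L^{q+1}(\mathbb{R})}^{1-\theta}\,\|u'\|_{L^p(\mathbb{R})}^{\theta}\quad\text{for all } u\in L^{q+1}(\mathbb{R})\text{ with } u'\in L^p(\mathbb{R}).$$ *)

theory Defs
  imports "HOL-Probability.Essential_Supremum"
begin

definition test_function_on :: "real set \<Rightarrow> (real \<Rightarrow> real) \<Rightarrow> bool" where
  "test_function_on S \<phi> \<longleftrightarrow>
     (\<forall>n. ((deriv ^^ n) \<phi>) differentiable_on UNIV) \<and>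
     (\<exists>K. compact K \<and> K \<subseteq> S \<and> (\<forall>x. x \<notin> K \<longrightarrow> \<phi> x = 0))"

definition locally_integrable_on :: "real set \<Rightarrow> (real \<Rightarrow> real) \<Rightarrow> bool" where
  "locally_integrable_on S f \<longleftrightarrow>
     (\<forall>K. compact K \<and> K \<subseteq> S \<longrightarrow> set_integrable lebesgue K f)"

text \<open>For an open set \<open>S\<close>: the identity \<open>f' = g\<close> in the sense of distributions on \<open>S\<close>,
  for locally integrable functions. The values of \<open>f\<close> and \<open>g\<close> outside \<open>S\<close> play no role.\<close>

definition has_weak_derivative_on :: "(real \<Rightarrow> real) \<Rightarrow> (real \<Rightarrow> real) \<Rightarrow> real set \<Rightarrow> bool" where
  "has_weak_derivative_on f g S \<longleftrightarrow>
     locally_integrable_on S f \<and> locally_integrable_on S g \<and>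
     (\<forall>\<phi>. test_function_on S \<phi> \<longrightarrow>
        (LINT x:S|lebesgue. f x * deriv \<phi> x) = - (LINT x:S|lebesgue. g x * \<phi> x))"

text \<open>Solutions are functions on the open half line: only the values at positive arguments matter.
  As \<open>0 powr a = 0\<close> for every \<open>a\<close>, including \<open>a = 0\<close> and \<open>a < 0\<close>, the source term
  \<open>u\<^sup>q\<close> vanishes where \<open>u\<close> does (also if \<open>q = 0\<close>), and
  \<open>\<bar>u'\<bar>\<^sup>p\<^sup>-\<^sup>2 u'\<close> vanishes where \<open>u'\<close> does (also if \<open>p \<le> 2\<close>).\<close>

definition is_solution :: "real \<Rightarrow> real \<Rightarrow> (real \<Rightarrow> real) \<Rightarrow> bool" where
  "is_solution p q u \<longleftrightarrow>
     (\<forall>r>0. 0 \<le> u r) \<and> antimono_on {0<..} u \<and> u C1_differentiable_on {0<..} \<and>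
     has_weak_derivative_on
       (\<lambda>r. \<bar>deriv u r\<bar> powr (p - 2) * deriv u r) (\<lambda>r. u r powr q) {0<..} \<and>
     (u \<longlongrightarrow> 1) (at_right 0) \<and> (u \<longlongrightarrow> 0) at_top"

definition in_Lp :: "real \<Rightarrow> (real \<Rightarrow> real) \<Rightarrow> bool" where
  "in_Lp s u \<longleftrightarrow> u \<in> borel_measurable lebesgue \<and> integrable lebesgue (\<lambda>x. \<bar>u x\<bar> powr s)"

definition Lp_norm :: "real \<Rightarrow> (real \<Rightarrow> real) \<Rightarrow> real" where
  "Lp_norm s u = (LINT x|lebesgue. \<bar>u x\<bar> powr s) powr (1 / s)"

definition Linf_norm :: "(real \<Rightarrow> real) \<Rightarrow> ereal" where
  "Linf_norm u = esssup lebesgue (\<lambda>x. ereal \<bar>u x\<bar>)"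

definition GN_theta :: "real \<Rightarrow> real \<Rightarrow> real" where
  "GN_theta p q = p / (p + (p - 1) * (q + 1))"

definition GN_inequality :: "real \<Rightarrow> real \<Rightarrow> real \<Rightarrow> bool" where
  "GN_inequality p q C \<longleftrightarrow>
     (\<forall>u v. in_Lp (q + 1) u \<and> has_weak_derivative_on u v UNIV \<and> in_Lp p v \<longrightarrow>
        Linf_norm u \<le>
          ereal (C * Lp_norm (q + 1) u powr (1 - GN_theta p q) * Lp_norm p v powr GN_theta p q))"

definition is_best_GN_constant :: "real \<Rightarrow> real \<Rightarrow> real \<Rightarrow> bool" where
  "is_best_GN_constant p q C \<longleftrightarrow>
     GN_inequality p q C \<and> (\<forall>C'. GN_inequality p q C' \<longrightarrow> C \<le> C')"

end

theory Submission
  imports Defs "HOL-Real_Asymp.Real_Asymp"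
begin

text \<open>
  A solution has the conserved energy
  \<open>(p - 1)/p \<bar>u'\<bar>\<^sup>p - u\<^sup>q\<^sup>+\<^sup>1/(q + 1)\<close>, which vanishes at infinity; hence the equation is equivalent to
  the first-order equation \<open>u' = - k u\<^sup>m\<close> with \<open>m = (q + 1)/p\<close>. Its right-hand side is decreasing in \<open>u\<close>,
  so the square of the difference of two solutions decreases from \<open>0\<close>, and the limit \<open>1\<close> at \<open>0\<close>
  determines the solution.

  For the inequality put \<open>s = 1 + (q + 1)(p - 1)/p\<close>. Integrating \<open>(\<bar>u\<bar>\<^sup>s)'\<close> from both ends gives
  \<open>2 \<bar>u(x)\<bar>\<^sup>s \<le> s \<integral> \<bar>u\<bar>\<^sup>s\<^sup>-\<^sup>1 \<bar>u'\<bar>\<close>, and Hoelder's inequality bounds the right-hand side by the two norms.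
  Both steps are equalities for the even extension of the solution of the first-order equation,
  since there \<open>\<bar>u'\<bar>\<^sup>p\<close> is proportional to \<open>\<bar>u\<bar>\<^sup>q\<^sup>+\<^sup>1\<close>.
\<close>

section \<open>Test functions\<close>

text \<open>All hypotheses are distributional: the flux of a solution has only a weak derivative,
  and the competitors in the inequality are merely weakly differentiable. So explicit smooth test
  functions are built, the lemma of du Bois-Reymond is proved for integrals over intervals, and an
  absolutely continuous function is handled as an indefinite integral of its density. The energy
  cannot be differentiated through \<open>u'\<close>, which is only continuous; it is rewritten in
  the flux \<open>W\<close>, since the \<open>p\<close>-th power of \<open>- u'\<close> is the power
  \<open>p / (p - 1)\<close> of \<open>- W\<close>. It vanishes at infinity because
  \<open>u'\<close> does: \<open>- u'\<close> is nonincreasing and \<open>u\<close> stays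
  nonnegative. The exponent \<open>s\<close> is forced by the Hoelder step: \<open>s - 1\<close>
  times the conjugate exponent of \<open>p\<close> must be \<open>q + 1\<close>. Moreover
  \<open>s = 1 / GN_theta p q\<close>, so the two-sided bound yields the constant
  \<open>(s / 2) powr (1 / s)\<close>. For the extremal function both norms come from the single
  integral of \<open>u powr (q + 1)\<close>, and the slope constant \<open>k\<close>
  cancels.\<close>

lemma DERIV_zero_of_quadratic_bound:
  fixes f :: "real \<Rightarrow> real"
  assumes "\<And>y. \<bar>f y - f x\<bar> \<le> K * (y - x)\<^sup>2"
  shows "(f has_real_derivative 0) (at x)"
proof -
  have "((\<lambda>y. (f y - f x) / (y - x)) \<longlongrightarrow> 0) (at x)"
  proof (rule Lim_null_comparison)
    show "\<forall>\<^sub>F y in at x. norm ((f y - f x) / (y - x)) \<le> K * \<bar>y - x\<bar>"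
    proof (rule eventually_mono[OF eventually_neq_at_within])
      fix y assume "y \<noteq> x"
      then have *: "\<bar>y - x\<bar> > 0" by simp
      have "\<bar>f y - f x\<bar> \<le> (K * \<bar>y - x\<bar>) * \<bar>y - x\<bar>"
        using assms[of y] by (simp add: power2_eq_square flip: abs_mult)
      then show "norm ((f y - f x) / (y - x)) \<le> K * \<bar>y - x\<bar>"
        using * by (simp add: divide_le_eq)
    qed
    show "((\<lambda>y. K * \<bar>y - x\<bar>) \<longlongrightarrow> 0) (at x)"
      by (auto intro!: tendsto_eq_intros)
  qed
  then show ?thesis by (simp add: has_field_derivative_iff)
qed

text \<open>A single term of the exponential series at \<open>c / y\<close> already gives the bound.
  It lets the exponential factor of a bump absorb every negative power at the end points of the
  support.\<close>

lemma power_exp_decay_bound: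
  fixes c y :: real
  assumes "c > 0" "y > 0"
  shows "exp (- c / y) / y ^ k \<le> fact k / c ^ k"
proof -
  have "(c / y) ^ k / fact k \<le> exp (c / y)"
  proof -
    have "(\<Sum>n\<in>{k}. (c / y) ^ n /\<^sub>R fact n) \<le> (\<Sum>n. (c / y) ^ n /\<^sub>R fact n)"
      by (rule sum_le_suminf) (use assms summable_exp[of "c / y"] in auto)
    then show ?thesis by (simp add: exp_def divide_inverse mult.commute)
  qed
  then have "c ^ k / y ^ k \<le> exp (c / y) * fact k"
    by (simp only: power_divide pos_divide_le_eq[OF fact_gt_zero])
  then have "c ^ k / y ^ k * exp (- c / y) \<le> exp (c / y) * fact k * exp (- c / y)"
    by (intro mult_right_mono) auto
  also have "\<dots> = fact k"
    by (simp add: exp_minus)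
  finally show ?thesis
    using assms by (simp add: field_simps)
qed

text \<open>The exponential times an arbitrary rational factor: this class of functions is closed under
  differentiation, so its members are smooth.\<close>

definition bump :: "real \<Rightarrow> real \<Rightarrow> real \<Rightarrow> real poly \<Rightarrow> nat \<Rightarrow> real \<Rightarrow> real" where
  "bump a b c P k x = (if a < x \<and> x < b
     then poly P x / ((x - a) * (b - x)) ^ k * exp (- c / ((x - a) * (b - x))) else 0)"

text \<open>Inside the interval, \<open>Q\<close> is the numerator that the quotient and chain rules
  produce over \<open>Y ^ (k + 2)\<close>, where \<open>Y\<close> is
  \<open>(x - a) * (b - x)\<close> as a polynomial. At and beyond the end points the derivative is
  0, by a quadratic bound on the increment.\<close>

lemma bump_has_derivative:
  fixes P :: "real poly" and k :: nat
  assumes "c > 0" and "a < b"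
  defines "Y \<equiv> [:- a * b, a + b, - 1:]"
  defines "Q \<equiv> pderiv P * Y\<^sup>2 - smult (of_nat k) (P * pderiv Y * Y) + smult c (P * pderiv Y)"
  shows "(bump a b c P k has_real_derivative bump a b c Q (k + 2) x) (at x)"
proof -
  have Y: "poly Y x = (x - a) * (b - x)" for x
    by (simp add: Y_def algebra_simps)
  show ?thesis
  proof (cases "a < x \<and> x < b")
    case True
    let ?y = "(x - a) * (b - x)"
    have y: "poly Y x > 0" using True by (simp add: Y)
    have "((\<lambda>x. poly P x / poly Y x ^ k * exp (- c / poly Y x)) has_real_derivative
        poly Q x / poly Y x ^ (k + 2) * exp (- c / poly Y x)) (at x)"
    proof (cases k)
      case 0
      show ?thesis unfolding 0
        using y by (auto intro!: derivative_eq_intros poly_DERIV simp: Q_def 0 field_simps power2_eq_square)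
    next
      case (Suc n)
      show ?thesis unfolding Suc
        using y
        apply (auto intro!: derivative_eq_intros poly_DERIV simp: Q_def Suc)
        apply (cases n; simp add: field_simps power2_eq_square)
        done
    qed
    then have "((\<lambda>x. poly P x / poly Y x ^ k * exp (- c / poly Y x)) has_real_derivative
        bump a b c Q (k + 2) x) (at x)"
      using True by (simp add: bump_def Y)
    then show ?thesis
    proof (rule has_field_derivative_transform_within_open[where S="{a<..<b}"])
      show "poly P z / poly Y z ^ k * exp (- c / poly Y z) = bump a b c P k z" if "z \<in> {a<..<b}" for z
        using that by (simp add: bump_def Y)
    qed (use True in auto)
  next
    case False
    obtain M where M: "\<And>y. y \<in> {a..b} \<Longrightarrow> \<bar>poly P y\<bar> \<le> M"
    proof -
      have "compact (poly P ` {a..b})"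
        by (intro compact_continuous_image continuous_intros) auto
      then show thesis using that compact_imp_bounded bounded_iff by (metis imageI real_norm_def)
    qed
    have M0: "M \<ge> 0" using M[of a] assms by force
    define N :: real where "N = fact (k + 2) / c ^ (k + 2)"
    have N0: "N > 0" using assms by (simp add: N_def)
    have "(bump a b c P k has_real_derivative 0) (at x)"
    proof (rule DERIV_zero_of_quadratic_bound)
      fix z
      have x0: "bump a b c P k x = 0" using False by (auto simp: bump_def)
      show "\<bar>bump a b c P k z - bump a b c P k x\<bar> \<le> M * N * (b - a)\<^sup>2 * (z - x)\<^sup>2"
      proof (cases "a < z \<and> z < b")
        case True
        define y where "y = (z - a) * (b - z)"
        have y: "y > 0" using True by (simp add: y_def)
        \<comment> \<open>Since \<open>x\<close> lies outside the open interval, one factor of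
          \<open>y\<close> is at most the distance from \<open>z\<close> to \<open>x\<close>, and
          the other is at most \<open>b - a\<close>.\<close>
        have y2: "y \<le> (b - a) * \<bar>z - x\<bar>"
        proof (cases "x \<le> a")
          case True
          then have "(z - a) * (b - z) \<le> \<bar>z - x\<bar> * (b - a)"
            using \<open>a < z \<and> z < b\<close> by (intro mult_mono) auto
          then show ?thesis by (simp add: y_def mult.commute)
        next
          case False
          then have "(z - a) * (b - z) \<le> (b - a) * \<bar>z - x\<bar>"
            using \<open>a < z \<and> z < b\<close> \<open>\<not> (a < x \<and> x < b)\<close> by (intro mult_mono) auto
          then show ?thesis by (simp add: y_def)
        qed
        have "\<bar>bump a b c P k z\<bar> = \<bar>poly P z\<bar> * (exp (- c / y) / y ^ k)"
          using True y by (simp add: bump_def abs_mult flip: y_def)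
        \<comment> \<open>Dividing by two further powers of \<open>y\<close> costs only the constant
          \<open>N\<close>; the freed \<open>y\<^sup>2\<close> is what is quadratic in
          \<open>z - x\<close>.\<close>
        also have "exp (- c / y) / y ^ k = exp (- c / y) / y ^ (k + 2) * y\<^sup>2"
          using y by (simp add: power_add power2_eq_square)
        also have "\<bar>poly P z\<bar> * (exp (- c / y) / y ^ (k + 2) * y\<^sup>2) \<le> M * (N * ((b - a) * \<bar>z - x\<bar>)\<^sup>2)"
        proof (intro mult_mono power_mono)
          show "exp (- c / y) / y ^ (k + 2) \<le> N"
            unfolding N_def by (rule power_exp_decay_bound) (use assms y in auto)
          show "\<bar>poly P z\<bar> \<le> M" using M True by auto
        qed (use y y2 M0 N0 in auto)
        finally show ?thesis unfolding x0 by (simp add: power_mult_distrib mult_ac)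
      next
        case False
        then show ?thesis using x0 M0 N0 by (auto simp: bump_def)
      qed
    qed
    then show ?thesis using False by (auto simp: bump_def)
  qed
qed

text \<open>Two bumps are treated together because the test functions below are primitives of a
  combination of two windows with mean zero. With the intervals and the exponential rates fixed,
  varying the polynomials and exponents gives a set \<open>X\<close> closed under
  differentiation.\<close>

lemma bump_lincomb_smooth:
  assumes "c > 0" "a < b" "c' > 0" "a' < b'"
  shows "((deriv ^^ n) (\<lambda>x. s * bump a b c P k x + t * bump a' b' c' P' k' x)) differentiable_on UNIV"
proof -
  define X where "X = {f. \<exists>P k P' k'. f = (\<lambda>x. s * bump a b c P k x + t * bump a' b' c' P' k' x)}"
  have X: "\<exists>g\<in>X. \<forall>x. (f has_real_derivative g x) (at x)" if "f \<in> X" for f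
  proof -
    from that obtain P k P' k' where f: "f = (\<lambda>x. s * bump a b c P k x + t * bump a' b' c' P' k' x)"
      unfolding X_def by blast
    note * = DERIV_add[OF DERIV_cmult[OF bump_has_derivative[OF assms(1,2), of P k], of s]
        DERIV_cmult[OF bump_has_derivative[OF assms(3,4), of P' k'], of t]]
    show ?thesis unfolding f X_def mem_Collect_eq
      by (rule bexI, rule allI, rule *) blast
  qed
  have "(deriv ^^ n) f \<in> X" if "f \<in> X" for f
  proof (induction n)
    case (Suc n)
    from X[OF Suc] obtain g where g: "g \<in> X" "\<forall>x. ((deriv ^^ n) f has_real_derivative g x) (at x)"
      by blast
    then have "deriv ((deriv ^^ n) f) = g"
      by (auto intro: DERIV_imp_deriv)
    then show ?case using g by simp
  qed (use that in simp)
  then have "(deriv ^^ n) (\<lambda>x. s * bump a b c P k x + t * bump a' b' c' P' k' x) \<in> X"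
    unfolding X_def by blast
  from X[OF this] show ?thesis
    by (meson differentiable_on_def differentiable_at_withinI real_differentiable_def)
qed

text \<open>The primitive that is 0 to the left of the support is 0 to the right of it as well,
  precisely because the mean of \<open>\<psi>\<close> vanishes.\<close>

lemma ex_test_function_with_deriv:
  fixes \<psi> :: "real \<Rightarrow> real"
  assumes smooth: "\<And>n. ((deriv ^^ n) \<psi>) differentiable_on UNIV"
    and supp: "\<And>x. x \<notin> {l..r} \<Longrightarrow> \<psi> x = 0"
    and int: "integral {l..r} \<psi> = 0" and "{l..r} \<subseteq> S"
  obtains \<phi> where "test_function_on S \<phi>" "deriv \<phi> = \<psi>"
proof -
  have cont: "continuous_on A \<psi>" for A
    using smooth[of 0] differentiable_imp_continuous_on continuous_on_subset by fastforce
  \<comment> \<open>Starting at \<open>l - 1\<close> keeps every \<open>x \<ge> l\<close> in the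
    interior of the interval of integration, so that the derivative of the primitive is two-sided
    there.\<close>
  define \<phi> where "\<phi> x = integral {l - 1..x} \<psi>" for x
  have intl: "\<psi> integrable_on {x..y}" for x y
    by (intro integrable_continuous_real cont)
  have left: "\<phi> x = 0" if "x < l" for x
    unfolding \<phi>_def using that supp by (subst integral_cong[where g="\<lambda>x. 0"]) auto
  have right: "\<phi> x = 0" if "x > r" for x
  proof (cases "l \<le> r")
    case True
    have "integral {l - 1..x} \<psi> = integral {l - 1..l} \<psi> + integral {l..x} \<psi>"
      using intl True that by (intro Henstock_Kurzweil_Integration.integral_combine[symmetric]) auto
    also have "integral {l..x} \<psi> = integral {l..r} \<psi> + integral {r..x} \<psi>"
      using intl True that by (intro Henstock_Kurzweil_Integration.integral_combine[symmetric]) auto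
    also have "integral {l - 1..l} \<psi> = 0"
      by (rule integral_unique, rule has_integral_spike_finite[of "{l}" _ _ "\<lambda>x. 0"]) (auto simp: supp)
    also have "integral {r..x} \<psi> = 0"
      by (rule integral_unique, rule has_integral_spike_finite[of "{r}" _ _ "\<lambda>x. 0"]) (auto simp: supp)
    finally show ?thesis using int by (simp add: \<phi>_def)
  next
    case False
    then have "\<psi> = (\<lambda>x. 0)" using supp by auto
    then show ?thesis by (simp add: \<phi>_def)
  qed
  have deriv: "(\<phi> has_real_derivative \<psi> x) (at x)" for x
  proof (cases "x < l")
    case True
    have "((\<lambda>x. 0) has_real_derivative \<psi> x) (at x)"
      using True supp[of x] by simp
    then show ?thesis
      by (rule has_field_derivative_transform_within_open[where S="{..<l}"]) (use True left in auto)
  next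
    case False
    have "(\<phi> has_real_derivative \<psi> x) (at x within {l - 1..x + 1})"
      unfolding \<phi>_def using False by (intro integral_has_real_derivative cont) auto
    then show ?thesis
      using False by (subst (asm) at_within_interior) auto
  qed
  have d: "deriv \<phi> = \<psi>"
    using deriv by (auto intro: DERIV_imp_deriv)
  have "((deriv ^^ n) \<phi>) differentiable_on UNIV" for n
  proof (cases n)
    case 0
    then show ?thesis using deriv
      by (auto simp: differentiable_on_def real_differentiable_def)
  next
    case (Suc m)
    then have "(deriv ^^ n) \<phi> = (deriv ^^ m) \<psi>"
      by (simp add: funpow_swap1 d)
    then show ?thesis using smooth by simp
  qed
  moreover have "\<phi> x = 0" if "x \<notin> {l..r}" for x
    using that left right by force
  ultimately have "test_function_on S \<phi>"
    unfolding test_function_on_def using assms(4) by (intro conjI exI[of _ "{l..r}"]) auto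
  then show thesis using d that by blast
qed

section \<open>Functions with vanishing weak derivative\<close>

text \<open>Smooth approximations of the indicator of the open interval: the rate
  \<open>1 / Suc n\<close> in the exponent tends to 0, and the values stay in \<open>[0, 1]\<close>,
  so dominated convergence applies.\<close>

definition window :: "real \<Rightarrow> real \<Rightarrow> nat \<Rightarrow> real \<Rightarrow> real" where
  "window a b n = bump a b (1 / real (Suc n)) [:1:] 0"

lemma window_eq_0: "x \<notin> {a..b} \<Longrightarrow> window a b n x = 0"
  by (auto simp: window_def bump_def)

lemma window_nonneg: "0 \<le> window a b n x"
  by (auto simp: window_def bump_def)

lemma window_le_1: "window a b n x \<le> 1"
  by (auto simp: window_def bump_def)

lemma window_tendsto: "(\<lambda>n. window a b n x) \<longlonglongrightarrow> indicator {a<..<b} x"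
proof (cases "a < x \<and> x < b")
  case True
  have "(\<lambda>n. exp (- (1 / real (Suc n)) * (1 / ((x - a) * (b - x))))) \<longlonglongrightarrow> exp (- 0 * (1 / ((x - a) * (b - x))))"
    by (intro tendsto_intros LIMSEQ_Suc lim_1_over_n)
  then show ?thesis using True by (simp add: window_def bump_def)
qed (auto simp: window_def bump_def)

lemma continuous_on_window: "a < b \<Longrightarrow> continuous_on A (window a b n)"
  unfolding window_def
  by (intro DERIV_continuous_on[OF DERIV_subset[OF bump_has_derivative]]) auto

lemma set_integrable_continuous_mult:
  fixes f g :: "real \<Rightarrow> real"
  assumes "continuous_on {a..b} f" "set_integrable lebesgue {a..b} g"
  shows "set_integrable lebesgue {a..b} (\<lambda>x. f x * g x)"
proof (intro absolutely_integrable_bounded_measurable_product_real assms)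
  show "f \<in> borel_measurable (lebesgue_on {a..b})"
    by (intro continuous_imp_measurable_on_sets_lebesgue assms) auto
  show "bounded (f ` {a..b})"
    by (intro compact_imp_bounded compact_continuous_image assms) auto
qed auto

lemma window_integral_tendsto:
  assumes "a < b" and h: "set_integrable lebesgue {a..b} h"
  shows "(\<lambda>n. integral {a..b} (\<lambda>x. h x * window a b n x)) \<longlonglongrightarrow> integral {a..b} h"
proof -
  have "(\<lambda>n. integral {a..b} (\<lambda>x. h x * window a b n x)) \<longlonglongrightarrow> integral {a..b} (\<lambda>x. h x * indicator {a<..<b} x)"
  proof (rule dominated_convergence)
    show "(\<lambda>x. h x * window a b n x) integrable_on {a..b}" for n
      using set_integrable_continuous_mult[OF continuous_on_window[OF assms(1)] h]
      by (intro set_lebesgue_integral_eq_integral) (simp add: mult.commute)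
    show "(\<lambda>x. \<bar>h x\<bar>) integrable_on {a..b}"
      by (intro set_lebesgue_integral_eq_integral set_integrable_abs h)
    show "norm (h x * window a b n x) \<le> \<bar>h x\<bar>" for n x
      by (simp add: abs_mult window_nonneg window_le_1 mult_left_le)
    show "(\<lambda>n. h x * window a b n x) \<longlonglongrightarrow> h x * indicator {a<..<b} x" for x
      by (intro tendsto_intros window_tendsto)
  qed
  also have "integral {a..b} (\<lambda>x. h x * indicator {a<..<b} x) = integral {a..b} h"
    by (rule integral_spike[of "{a, b}"]) (auto simp: indicator_def)
  finally show ?thesis .
qed

text \<open>The weak formulations use Lebesgue integrals over \<open>S\<close>, the calculations use
  the integral over a compact interval that contains the support; this is the passage between
  them.\<close>

lemma set_integral_compact_support:
  fixes h \<psi> :: "real \<Rightarrow> real"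
  assumes sub: "{a..b} \<subseteq> S" and h: "set_integrable lebesgue {a..b} h"
    and cont: "continuous_on {a..b} \<psi>" and supp: "\<And>x. x \<notin> {a..b} \<Longrightarrow> \<psi> x = 0"
  shows "set_integrable lebesgue S (\<lambda>x. h x * \<psi> x)"
    "(LINT x:S|lebesgue. h x * \<psi> x) = integral {a..b} (\<lambda>x. h x * \<psi> x)"
proof -
  have *: "(\<lambda>x. indicator S x *\<^sub>R (h x * \<psi> x)) = (\<lambda>x. indicator {a..b} x *\<^sub>R (h x * \<psi> x))"
    using sub supp by (auto simp: indicator_def fun_eq_iff)
  have i: "set_integrable lebesgue {a..b} (\<lambda>x. h x * \<psi> x)"
    using set_integrable_continuous_mult[OF cont h] by (simp add: mult.commute)
  then show "set_integrable lebesgue S (\<lambda>x. h x * \<psi> x)"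
    unfolding set_integrable_def * .
  show "(LINT x:S|lebesgue. h x * \<psi> x) = integral {a..b} (\<lambda>x. h x * \<psi> x)"
    unfolding set_lebesgue_integral_eq_integral(2)[OF i, symmetric]
    by (simp only: set_lebesgue_integral_def *)
qed

text \<open>The lemma of du Bois-Reymond in integrated form: all intervals give \<open>h\<close> the
  same mean. Testing with a mean-zero combination of the windows of two intervals and letting
  \<open>n\<close> tend to infinity compares their means.\<close>

lemma ex_mean_of_weak_derivative_zero:
  assumes S: "is_interval S" and h: "locally_integrable_on S h"
    and zero: "\<And>\<phi>. test_function_on S \<phi> \<Longrightarrow> (LINT x:S|lebesgue. h x * deriv \<phi> x) = 0"
  obtains m where "\<And>a b. a < b \<Longrightarrow> {a..b} \<subseteq> S \<Longrightarrow> integral {a..b} h = m * (b - a)"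
proof -
  have hi: "set_integrable lebesgue {a..b} h" if "{a..b} \<subseteq> S" for a b
    using h that by (auto simp: locally_integrable_on_def)
  have key: "(d - c) * integral {a..b} h = (b - a) * integral {c..d} h"
    if ab: "a < b" "{a..b} \<subseteq> S" and cd: "c < d" "{c..d} \<subseteq> S" for a b c d
  proof -
    have eq: "integral {c..d} (window c d n) * integral {a..b} (\<lambda>x. h x * window a b n x)
       = integral {a..b} (window a b n) * integral {c..d} (\<lambda>x. h x * window c d n x)" for n
    proof -
      define I where "I = integral {a..b} (window a b n)"
      define J where "J = integral {c..d} (window c d n)"
      \<comment> \<open>Weighting each window by the integral of the other gives mean zero, the
        condition for \<open>\<psi>\<close> to be the derivative of a test function.\<close>
      define \<psi> where "\<psi> x = J * window a b n x + (- I) * window c d n x" for x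
      define l where "l = min a c"
      define r where "r = max b d"
      have lr: "{a..b} \<subseteq> {l..r}" "{c..d} \<subseteq> {l..r}" by (auto simp: l_def r_def)
      have "l \<in> S \<and> r \<in> S" using ab cd by (auto simp: l_def r_def min_def max_def)
      then have lrS: "{l..r} \<subseteq> S"
        using mem_is_interval_1_I[OF S] by (meson atLeastAtMost_iff subsetI)
      have ext: "(if x \<in> {a'..b'} then window a' b' n x else 0) = window a' b' n x" for x a' b'
        by (simp add: window_eq_0)
      have restrict: "integral T (\<lambda>x. if x \<in> A then f x else 0) = integral A f" if "A \<subseteq> T" for A T and f :: "real \<Rightarrow> real"
        using that by (simp add: integral_restrict_Int Int_absorb2)
      have int: "integral {l..r} (window a b n) = I" "integral {l..r} (window c d n) = J"
        using restrict[OF lr(1), of "window a b n"]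
          restrict[OF lr(2), of "window c d n"]
        unfolding ext I_def J_def .
      obtain \<phi> where \<phi>: "test_function_on S \<phi>" "deriv \<phi> = \<psi>"
      proof (rule ex_test_function_with_deriv[OF _ _ _ lrS])
        show "((deriv ^^ k) \<psi>) differentiable_on UNIV" for k
          unfolding \<psi>_def window_def by (rule bump_lincomb_smooth) (use ab cd in auto)
        show "\<psi> x = 0" if "x \<notin> {l..r}" for x
          using that lr by (auto simp: \<psi>_def window_eq_0)
        have "integral {l..r} \<psi> = J * I + (- I) * J"
          unfolding \<psi>_def
          by (subst Henstock_Kurzweil_Integration.integral_add)
             (auto intro!: integrable_on_mult_right integrable_continuous_real continuous_intros continuous_on_window ab cd simp: int)
        then show "integral {l..r} \<psi> = 0" by simp
      qed
      have w: "set_integrable lebesgue S (\<lambda>x. h x * window a b n x)"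
        "(LINT x:S|lebesgue. h x * window a b n x) = integral {a..b} (\<lambda>x. h x * window a b n x)"
        if "a < b" "{a..b} \<subseteq> S" for a b
        using that by (auto intro!: set_integral_compact_support hi continuous_on_window window_eq_0)
      have "0 = (LINT x:S|lebesgue. h x * \<psi> x)"
        using zero[OF \<phi>(1)] \<phi>(2) by simp
      also have "\<dots> = (LINT x:S|lebesgue. J * (h x * window a b n x) + (- I) * (h x * window c d n x))"
        by (simp add: \<psi>_def right_diff_distrib mult.left_commute)
      also have "\<dots> = J * integral {a..b} (\<lambda>x. h x * window a b n x) + (- I) * integral {c..d} (\<lambda>x. h x * window c d n x)"
        using set_integral_add(2)[OF set_integrable_mult_right[OF w(1)[OF ab], of J]
            set_integrable_mult_right[OF w(1)[OF cd], of "- I"]]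
        by (simp only: set_integral_mult_right w(2)[OF ab] w(2)[OF cd])
      finally show ?thesis by (simp add: I_def J_def)
    qed
    have one: "(\<lambda>n. integral {a..b} (window a b n)) \<longlonglongrightarrow> b - a" if "a < b" for a b
      using window_integral_tendsto[of a b "\<lambda>x. 1"] that
      by (auto simp: absolutely_integrable_continuous_real)
    show ?thesis
      using tendsto_mult[OF one[OF cd(1)] window_integral_tendsto[OF ab(1) hi[OF ab(2)]]]
        tendsto_mult[OF one[OF ab(1)] window_integral_tendsto[OF cd(1) hi[OF cd(2)]]]
      unfolding eq by (rule LIMSEQ_unique)
  qed
  show thesis
  \<comment> \<open>If \<open>S\<close> contains no nondegenerate interval, every \<open>m\<close>
    qualifies; otherwise \<open>m\<close> is the mean of \<open>h\<close> over one fixed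
    interval.\<close>
  proof (cases "\<exists>c d. c < d \<and> {c..d} \<subseteq> S")
    case True
    then obtain c d where cd: "c < d" "{c..d} \<subseteq> S" by auto
    show thesis
    proof (rule that)
      fix a b assume "a < b" "{a..b} \<subseteq> S"
      from key[OF this cd] show "integral {a..b} h = integral {c..d} h / (d - c) * (b - a)"
        using cd by (simp add: field_simps)
    qed
  qed (use that in blast)
qed

section \<open>Indefinite integrals and integration by parts\<close>

text \<open>Replaces differentiation almost everywhere of absolutely continuous functions: errors of size
  \<open>\<epsilon> (B y - B x)\<close> on short intervals telescope.\<close>

lemma le_of_locally_le:
  fixes A B :: "real \<Rightarrow> real"
  assumes "a \<le> b"
    and loc: "\<And>\<epsilon>. \<epsilon> > 0 \<Longrightarrow> \<exists>\<delta>>0. \<forall>x y. a \<le> x \<longrightarrow> x \<le> y \<longrightarrow> y \<le> b \<longrightarrow> y - x < \<delta> \<longrightarrow>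
      A y - A x \<le> \<epsilon> * (B y - B x)"
  shows "A b \<le> A a"
proof -
  have le: "A b - A a \<le> \<epsilon> * (B b - B a)" if "\<epsilon> > 0" for \<epsilon>
  proof -
    from loc[OF that] obtain \<delta> where \<delta>: "\<delta> > 0"
      "\<And>x y. a \<le> x \<Longrightarrow> x \<le> y \<Longrightarrow> y \<le> b \<Longrightarrow> y - x < \<delta> \<Longrightarrow> A y - A x \<le> \<epsilon> * (B y - B x)"
      by blast
    obtain N :: nat where N: "(b - a) / \<delta> < real N"
      using reals_Archimedean2 by blast
    have N0: "real N > 0"
      using N assms(1) \<delta>(1) by (smt (verit) divide_nonneg_pos)
    define t where "t = (b - a) / real N"
    have t: "t \<ge> 0" "t < \<delta>"
      using N N0 assms(1) \<delta>(1) by (auto simp: t_def field_simps)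
    have "A (a + real i * t) - A a \<le> \<epsilon> * (B (a + real i * t) - B a)" if "i \<le> N" for i
      using that
    proof (induction i)
      case (Suc i)
      have "real (Suc i) * t \<le> real N * t"
        using Suc.prems t by (intro mult_right_mono) auto
      also have "\<dots> = b - a" using N0 by (simp add: t_def)
      finally have "A (a + real (Suc i) * t) - A (a + real i * t)
          \<le> \<epsilon> * (B (a + real (Suc i) * t) - B (a + real i * t))"
        using t by (intro \<delta>(2)) (auto simp: algebra_simps)
      with Suc show ?case by (simp add: algebra_simps)
    qed simp
    from this[of N] show ?thesis using N0 by (simp add: t_def)
  qed
  show ?thesis
  \<comment> \<open>\<open>B\<close> is not assumed monotone. If it does not grow from
    \<open>a\<close> to \<open>b\<close>, the choice \<open>\<epsilon> = 1\<close> already gives the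
    claim.\<close>
  proof (cases "B b - B a > 0")
    case True
    have "A b - A a \<le> 0"
    proof (rule field_le_epsilon)
      fix e :: real assume "e > 0"
      with le[of "e / (B b - B a)"] True show "A b - A a \<le> 0 + e" by simp
    qed
    then show ?thesis by simp
  next
    case False
    then have "B b - B a \<le> 0" by simp
    then have "1 * (B b - B a) \<le> 0" by simp
    with le[of 1] show ?thesis by linarith
  qed
qed

text \<open>Absolute continuity of \<open>F\<close> on the interval with density \<open>f\<close>,
  expressed by the fundamental theorem of calculus. It fixes the increments of \<open>F\<close>
  between all points, whereas \<open>f\<close> may be changed on null sets.\<close>

definition indefinite_integral_of :: "(real \<Rightarrow> real) \<Rightarrow> (real \<Rightarrow> real) \<Rightarrow> real \<Rightarrow> real \<Rightarrow> bool" where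
  "indefinite_integral_of F f a b \<longleftrightarrow> set_integrable lebesgue {a..b} f \<and>
     (\<forall>x y. a \<le> x \<longrightarrow> x \<le> y \<longrightarrow> y \<le> b \<longrightarrow> F y - F x = integral {x..y} f)"

lemma indefinite_integral_ofD:
  assumes "indefinite_integral_of F f a b"
  shows "set_integrable lebesgue {a..b} f" "a \<le> x \<Longrightarrow> x \<le> y \<Longrightarrow> y \<le> b \<Longrightarrow> F y - F x = integral {x..y} f"
    "a \<le> x \<Longrightarrow> y \<le> b \<Longrightarrow> set_integrable lebesgue {x..y} f"
    "a \<le> x \<Longrightarrow> y \<le> b \<Longrightarrow> f integrable_on {x..y}"
proof -
  show *: "set_integrable lebesgue {a..b} f" "a \<le> x \<Longrightarrow> x \<le> y \<Longrightarrow> y \<le> b \<Longrightarrow> F y - F x = integral {x..y} f"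
    using assms by (auto simp: indefinite_integral_of_def)
  show "set_integrable lebesgue {x..y} f" if "a \<le> x" "y \<le> b"
    by (rule set_integrable_subset[OF *(1)]) (use that in auto)
  then show "f integrable_on {x..y}" if "a \<le> x" "y \<le> b"
    using that set_lebesgue_integral_eq_integral(1) by blast
qed

lemma indefinite_integral_of_continuous_on:
  assumes "indefinite_integral_of F f a b"
  shows "continuous_on {a..b} F"
proof -
  have "continuous_on {a..b} (\<lambda>x. F a + integral {a..x} f)"
    by (intro continuous_intros indefinite_integral_continuous_1 indefinite_integral_ofD(4)[OF assms]) auto
  then show ?thesis
  proof (rule continuous_on_eq)
    show "F a + integral {a..x} f = F x" if "x \<in> {a..b}" for x
      using indefinite_integral_ofD(2)[OF assms, of a x] that by auto
  qed
qed

lemma integral_lebesgue_abs_le: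
  fixes f :: "real \<Rightarrow> real"
  assumes "set_integrable lebesgue {a..b} f"
  shows "\<bar>integral {a..b} f\<bar> \<le> integral {a..b} (\<lambda>x. \<bar>f x\<bar>)"
proof -
  have "norm (integral {a..b} f) \<le> integral {a..b} (\<lambda>x. \<bar>f x\<bar>)"
    by (intro integral_norm_bound_integral set_lebesgue_integral_eq_integral(1) set_integrable_abs assms) auto
  then show ?thesis by simp
qed

lemma uniform_continuity_real:
  fixes f :: "real \<Rightarrow> real"
  assumes "continuous_on {a..b} f" "e > 0"
  obtains d where "d > 0" "\<And>x y. x \<in> {a..b} \<Longrightarrow> y \<in> {a..b} \<Longrightarrow> \<bar>y - x\<bar> < d \<Longrightarrow> \<bar>f y - f x\<bar> < e"
  using compact_uniformly_continuous[OF assms(1)] assms(2)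
  unfolding uniformly_continuous_on_def dist_real_def by (metis compact_Icc)

text \<open>The product minus the integral, called \<open>A\<close>, changes over short intervals by
  at most \<open>\<epsilon>\<close> times the increment of \<open>B\<close>. Telescoping this for
  \<open>A\<close> and for \<open>- A\<close> gives \<open>A b = A a\<close>.\<close>

lemma indefinite_integral_by_parts:
  assumes F: "indefinite_integral_of F f a b" and G: "indefinite_integral_of G g a b" and "a \<le> b"
  shows "set_integrable lebesgue {a..b} (\<lambda>t. f t * G t + F t * g t)" (is ?th1)
    "integral {a..b} (\<lambda>t. f t * G t + F t * g t) = F b * G b - F a * G a" (is ?th2)
proof -
  note FD = indefinite_integral_ofD[OF F] and GD = indefinite_integral_ofD[OF G]
  note Fc = indefinite_integral_of_continuous_on[OF F] and Gc = indefinite_integral_of_continuous_on[OF G]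
  have i0: "set_integrable lebesgue {a..b} (\<lambda>t. f t * G t + F t * g t)"
    using set_integrable_continuous_mult[OF Fc GD(1)] set_integrable_continuous_mult[OF Gc FD(1)]
    by (intro set_integral_add) (auto simp: mult.commute)
  then show ?th1 .
  have i: "(\<lambda>t. f t * G t + F t * g t) integrable_on {x..y}" if "a \<le> x" "y \<le> b" for x y
    by (rule set_lebesgue_integral_eq_integral, rule set_integrable_subset[OF i0]) (use that in auto)
  have j0: "set_integrable lebesgue {a..b} (\<lambda>t. \<bar>f t\<bar> + \<bar>g t\<bar>)"
    by (intro set_integral_add set_integrable_abs FD GD)
  then have j: "(\<lambda>t. \<bar>f t\<bar> + \<bar>g t\<bar>) integrable_on {x..y}" if "a \<le> x" "y \<le> b" for x y
    by (intro set_lebesgue_integral_eq_integral, elim set_integrable_subset) (use that in auto)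
  define A where "A z = F z * G z - integral {a..z} (\<lambda>t. f t * G t + F t * g t)" for z
  define B where "B z = integral {a..z} (\<lambda>t. \<bar>f t\<bar> + \<bar>g t\<bar>)" for z
  have key: "\<exists>\<delta>>0. \<forall>x y. a \<le> x \<longrightarrow> x \<le> y \<longrightarrow> y \<le> b \<longrightarrow> y - x < \<delta> \<longrightarrow> \<bar>A y - A x\<bar> \<le> \<epsilon> * (B y - B x)"
    if eps: "\<epsilon> > 0" for \<epsilon>
  proof -
    obtain d1 where d1: "d1 > 0" "\<And>x y. x \<in> {a..b} \<Longrightarrow> y \<in> {a..b} \<Longrightarrow> \<bar>y - x\<bar> < d1 \<Longrightarrow> \<bar>F y - F x\<bar> < \<epsilon>"
      using uniform_continuity_real[OF Fc eps] by blast
    obtain d2 where d2: "d2 > 0" "\<And>x y. x \<in> {a..b} \<Longrightarrow> y \<in> {a..b} \<Longrightarrow> \<bar>y - x\<bar> < d2 \<Longrightarrow> \<bar>G y - G x\<bar> < \<epsilon>"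
      using uniform_continuity_real[OF Gc eps] by blast
    have "\<bar>A y - A x\<bar> \<le> \<epsilon> * (B y - B x)" if xy: "a \<le> x" "x \<le> y" "y \<le> b" "y - x < min d1 d2" for x y
    proof -
      have fi: "f integrable_on {x..y}" "g integrable_on {x..y}" using FD GD xy by auto
      have *: "integral {a..y} (\<lambda>t. f t * G t + F t * g t)
          = integral {a..x} (\<lambda>t. f t * G t + F t * g t) + integral {x..y} (\<lambda>t. f t * G t + F t * g t)"
        "integral {a..y} (\<lambda>t. \<bar>f t\<bar> + \<bar>g t\<bar>) = integral {a..x} (\<lambda>t. \<bar>f t\<bar> + \<bar>g t\<bar>) + integral {x..y} (\<lambda>t. \<bar>f t\<bar> + \<bar>g t\<bar>)"
        using xy by (auto intro!: Henstock_Kurzweil_Integration.integral_combine[symmetric] i j)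
      \<comment> \<open>With \<open>G\<close> frozen at \<open>y\<close> and \<open>F\<close> at
        \<open>x\<close>, the increments become integrals with constant factors. The deviation from
        the true integrand is \<open>f t * (G y - G t) - (F t - F x) * g t\<close>, which uniform
        continuity controls.\<close>
      have "F y * G y - F x * G x = (F y - F x) * G y + F x * (G y - G x)"
        by (simp add: algebra_simps)
      also have "\<dots> = integral {x..y} (\<lambda>t. f t * G y + F x * g t)"
        using FD(2)[of x y] GD(2)[of x y] xy fi
        by (subst Henstock_Kurzweil_Integration.integral_add)
           (auto intro!: integrable_on_mult_left integrable_on_mult_right)
      finally have "A y - A x = integral {x..y} (\<lambda>t. f t * G y + F x * g t) - integral {x..y} (\<lambda>t. f t * G t + F t * g t)"
        using * by (simp add: A_def)
      also have "\<dots> = integral {x..y} (\<lambda>t. (f t * G y + F x * g t) - (f t * G t + F t * g t))"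
        using fi xy by (intro Henstock_Kurzweil_Integration.integral_diff[symmetric] i integrable_add
            integrable_on_mult_left integrable_on_mult_right) auto
      finally have "A y - A x = integral {x..y} (\<lambda>t. (f t * G y + F x * g t) - (f t * G t + F t * g t))" .
      moreover have "norm (integral {x..y} (\<lambda>t. (f t * G y + F x * g t) - (f t * G t + F t * g t)))
         \<le> integral {x..y} (\<lambda>t. \<epsilon> * (\<bar>f t\<bar> + \<bar>g t\<bar>))"
      proof (rule integral_norm_bound_integral)
        show "(\<lambda>t. (f t * G y + F x * g t) - (f t * G t + F t * g t)) integrable_on {x..y}"
          using fi xy by (intro integrable_diff i integrable_add
            integrable_on_mult_left integrable_on_mult_right) auto
        show "(\<lambda>t. \<epsilon> * (\<bar>f t\<bar> + \<bar>g t\<bar>)) integrable_on {x..y}"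
          using xy by (intro integrable_on_mult_right j) auto
        fix t assume t: "t \<in> {x..y}"
        have "\<bar>F t - F x\<bar> < \<epsilon>" using t xy by (intro d1) auto
        moreover have "\<bar>G y - G t\<bar> < \<epsilon>" using t xy by (intro d2) auto
        ultimately have "\<bar>f t * (G y - G t)\<bar> + \<bar>(F t - F x) * g t\<bar> \<le> \<bar>f t\<bar> * \<epsilon> + \<epsilon> * \<bar>g t\<bar>"
          unfolding abs_mult by (intro add_mono mult_mono) auto
        moreover have "(f t * G y + F x * g t) - (f t * G t + F t * g t) = f t * (G y - G t) - (F t - F x) * g t"
          by (simp add: algebra_simps)
        ultimately show "norm ((f t * G y + F x * g t) - (f t * G t + F t * g t)) \<le> \<epsilon> * (\<bar>f t\<bar> + \<bar>g t\<bar>)"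
          by (simp add: algebra_simps)
      qed
      ultimately show ?thesis using * by (simp add: B_def)
    qed
    then show ?thesis using d1(1) d2(1) by (intro exI[of _ "min d1 d2"]) auto
  qed
  have "A b \<le> A a"
    by (rule le_of_locally_le[OF \<open>a \<le> b\<close>, where B = B]) (use key in \<open>meson abs_le_iff order_trans abs_ge_self\<close>)
  moreover have "- A b \<le> - A a"
  proof (rule le_of_locally_le[OF \<open>a \<le> b\<close>, where B = B])
    fix \<epsilon> :: real assume "\<epsilon> > 0"
    from key[OF this] obtain \<delta> where \<delta>: "\<delta> > 0" and
      *: "\<And>x y. a \<le> x \<Longrightarrow> x \<le> y \<Longrightarrow> y \<le> b \<Longrightarrow> y - x < \<delta> \<Longrightarrow> \<bar>A y - A x\<bar> \<le> \<epsilon> * (B y - B x)" by blast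
    have "- A y - - A x \<le> \<epsilon> * (B y - B x)" if "a \<le> x" "x \<le> y" "y \<le> b" "y - x < \<delta>" for x y
      using *[OF that] by linarith
    with \<delta> show "\<exists>\<delta>>0. \<forall>x y. a \<le> x \<longrightarrow> x \<le> y \<longrightarrow> y \<le> b \<longrightarrow> y - x < \<delta> \<longrightarrow> - A y - - A x \<le> \<epsilon> * (B y - B x)"
      by blast
  qed
  ultimately show ?th2 by (simp add: A_def)
qed

text \<open>The mean value theorem with the derivative bounded by its value at \<open>y\<close>; for
  \<open>y \<le> x\<close> the left-hand side is nonpositive. The case \<open>x = 0\<close> is
  computed directly, because the power rule asks for a positive base.\<close>

lemma powr_diff_le:
  fixes x y s :: real
  assumes "s > 1" "x \<ge> 0" "y \<ge> 0"
  shows "y powr s - x powr s \<le> s * y powr (s - 1) * \<bar>y - x\<bar>"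
proof (cases "x < y")
  case True
  show ?thesis
  proof (cases "x = 0")
    case True
    then have "y powr s = y powr (s - 1) * y" using \<open>x < y\<close> by (simp add: powr_diff)
    also have "\<dots> \<le> s * (y powr (s - 1) * y)" using assms by (intro mult_right_mono[of 1 s, simplified]) auto
    finally show ?thesis using True assms by (simp add: mult.assoc)
  next
    case False
    have "((\<lambda>t. t powr s) has_real_derivative s * t powr (s - 1)) (at t)" if "x \<le> t" for t
      using that False assms by (intro has_real_derivative_powr) auto
    then obtain z where z: "x < z" "z < y" "y powr s - x powr s = (y - x) * (s * z powr (s - 1))"
      using MVT2[OF True, of "\<lambda>t. t powr s" "\<lambda>t. s * t powr (s - 1)"] by blast
    have "z powr (s - 1) \<le> y powr (s - 1)"
      using z assms by (intro powr_mono2) auto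
    then have "(y - x) * (s * z powr (s - 1)) \<le> (y - x) * (s * y powr (s - 1))"
      using True assms by (intro mult_left_mono) auto
    then show ?thesis using z True by (simp add: mult_ac)
  qed
next
  case False
  then have "y powr s \<le> x powr s" using assms by (intro powr_mono2) auto
  moreover have "0 \<le> s * y powr (s - 1) * \<bar>y - x\<bar>" using assms by auto
  ultimately show ?thesis by linarith
qed

text \<open>The chain rule for the power \<open>s\<close>, as an inequality: on a short interval the
  factor \<open>\<bar>F y\<bar> powr (s - 1)\<close> differs from its value at \<open>t\<close> by
  less than \<open>\<epsilon>\<close>, which costs \<open>\<epsilon>\<close> times the increment of
  \<open>B\<close>.\<close>

lemma indefinite_integral_powr_le:
  assumes F: "indefinite_integral_of F f a b" and "a \<le> b" "s > 1"
  shows "set_integrable lebesgue {a..b} (\<lambda>t. \<bar>F t\<bar> powr (s - 1) * \<bar>f t\<bar>)" (is ?th1)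
    "\<bar>F b\<bar> powr s - \<bar>F a\<bar> powr s \<le> s * integral {a..b} (\<lambda>t. \<bar>F t\<bar> powr (s - 1) * \<bar>f t\<bar>)" (is ?th2)
proof -
  note FD = indefinite_integral_ofD[OF F] and Fc = indefinite_integral_of_continuous_on[OF F]
  have Pc: "continuous_on {a..b} (\<lambda>t. \<bar>F t\<bar> powr (s - 1))"
    using \<open>s > 1\<close> by (intro continuous_on_powr' continuous_intros Fc) auto
  have j0: "set_integrable lebesgue {a..b} (\<lambda>t. \<bar>f t\<bar>)"
    by (intro set_integrable_abs FD)
  then have j: "(\<lambda>t. \<bar>f t\<bar>) integrable_on {x..y}" if "a \<le> x" "y \<le> b" for x y
    by (intro set_lebesgue_integral_eq_integral, elim set_integrable_subset) (use that in auto)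
  show i0: ?th1
    by (intro set_integrable_continuous_mult Pc j0)
  then have i: "(\<lambda>t. \<bar>F t\<bar> powr (s - 1) * \<bar>f t\<bar>) integrable_on {x..y}" if "a \<le> x" "y \<le> b" for x y
    by (intro set_lebesgue_integral_eq_integral, elim set_integrable_subset) (use that in auto)
  define A where "A z = \<bar>F z\<bar> powr s - s * integral {a..z} (\<lambda>t. \<bar>F t\<bar> powr (s - 1) * \<bar>f t\<bar>)" for z
  define B where "B z = s * integral {a..z} (\<lambda>t. \<bar>f t\<bar>)" for z
  have "A b \<le> A a"
  proof (rule le_of_locally_le[OF \<open>a \<le> b\<close>, where B = B])
    fix \<epsilon> :: real assume "\<epsilon> > 0"
    obtain d where d: "d > 0" "\<And>x y. x \<in> {a..b} \<Longrightarrow> y \<in> {a..b} \<Longrightarrow> \<bar>y - x\<bar> < d \<Longrightarrow>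
        \<bar>\<bar>F y\<bar> powr (s - 1) - \<bar>F x\<bar> powr (s - 1)\<bar> < \<epsilon>"
      using uniform_continuity_real[OF Pc \<open>\<epsilon> > 0\<close>] by blast
    have "A y - A x \<le> \<epsilon> * (B y - B x)" if xy: "a \<le> x" "x \<le> y" "y \<le> b" "y - x < d" for x y
    proof -
      have *: "integral {a..y} (\<lambda>t. \<bar>F t\<bar> powr (s - 1) * \<bar>f t\<bar>)
          = integral {a..x} (\<lambda>t. \<bar>F t\<bar> powr (s - 1) * \<bar>f t\<bar>) + integral {x..y} (\<lambda>t. \<bar>F t\<bar> powr (s - 1) * \<bar>f t\<bar>)"
        "integral {a..y} (\<lambda>t. \<bar>f t\<bar>) = integral {a..x} (\<lambda>t. \<bar>f t\<bar>) + integral {x..y} (\<lambda>t. \<bar>f t\<bar>)"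
        using xy by (auto intro!: Henstock_Kurzweil_Integration.integral_combine[symmetric] i j)
      have "\<bar>F y\<bar> powr s - \<bar>F x\<bar> powr s \<le> s * \<bar>F y\<bar> powr (s - 1) * \<bar>\<bar>F y\<bar> - \<bar>F x\<bar>\<bar>"
        by (rule powr_diff_le) (use \<open>s > 1\<close> in auto)
      also have "\<dots> \<le> s * \<bar>F y\<bar> powr (s - 1) * \<bar>integral {x..y} f\<bar>"
        using FD(2)[of x y] xy \<open>s > 1\<close> by (intro mult_left_mono) auto
      also have "\<dots> \<le> s * \<bar>F y\<bar> powr (s - 1) * integral {x..y} (\<lambda>t. \<bar>f t\<bar>)"
        using \<open>s > 1\<close> xy by (intro mult_left_mono integral_lebesgue_abs_le FD(3)) auto
      also have "\<dots> = s * integral {x..y} (\<lambda>t. \<bar>F y\<bar> powr (s - 1) * \<bar>f t\<bar>)"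
        by simp
      also have "\<dots> \<le> s * integral {x..y} (\<lambda>t. \<bar>F t\<bar> powr (s - 1) * \<bar>f t\<bar> + \<epsilon> * \<bar>f t\<bar>)"
      proof (intro mult_left_mono integral_le)
        fix t assume "t \<in> {x..y}"
        then have "\<bar>\<bar>F y\<bar> powr (s - 1) - \<bar>F t\<bar> powr (s - 1)\<bar> < \<epsilon>"
          using xy by (intro d) auto
        then have "\<bar>F y\<bar> powr (s - 1) * \<bar>f t\<bar> \<le> (\<bar>F t\<bar> powr (s - 1) + \<epsilon>) * \<bar>f t\<bar>"
          by (intro mult_right_mono) auto
        then show "\<bar>F y\<bar> powr (s - 1) * \<bar>f t\<bar> \<le> \<bar>F t\<bar> powr (s - 1) * \<bar>f t\<bar> + \<epsilon> * \<bar>f t\<bar>"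
          by (simp add: algebra_simps)
      qed (use xy \<open>s > 1\<close> in \<open>auto intro!: integrable_on_mult_right integrable_add i j\<close>)
      also have "\<dots> = s * (integral {x..y} (\<lambda>t. \<bar>F t\<bar> powr (s - 1) * \<bar>f t\<bar>) + \<epsilon> * integral {x..y} (\<lambda>t. \<bar>f t\<bar>))"
        using xy by (subst Henstock_Kurzweil_Integration.integral_add) (auto intro!: integrable_on_mult_right i j)
      finally show ?thesis using * by (simp add: A_def B_def algebra_simps)
    qed
    then show "\<exists>\<delta>>0. \<forall>x y. a \<le> x \<longrightarrow> x \<le> y \<longrightarrow> y \<le> b \<longrightarrow> y - x < \<delta> \<longrightarrow> A y - A x \<le> \<epsilon> * (B y - B x)"
      using d(1) by blast
  qed
  then show ?th2 by (simp add: A_def)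
qed

section \<open>Weak derivatives and indefinite integrals\<close>

lemma compact_subset_open_intervalE:
  fixes S :: "real set"
  assumes "compact K" "K \<subseteq> S" "open S" "is_interval S" "K \<noteq> {}"
  obtains a b where "a \<le> b" "{a..b} \<subseteq> S" "K \<subseteq> {a<..<b}"
proof -
  obtain l where l: "l \<in> K" "\<And>x. x \<in> K \<Longrightarrow> l \<le> x"
    using compact_attains_inf[OF assms(1,5)] by blast
  obtain r where r: "r \<in> K" "\<And>x. x \<in> K \<Longrightarrow> x \<le> r"
    using compact_attains_sup[OF assms(1,5)] by blast
  obtain e where e: "e > 0" "cball l e \<subseteq> S"
    using \<open>open S\<close> l(1) assms(2) open_contains_cball by (metis subsetD)
  obtain e' where e': "e' > 0" "cball r e' \<subseteq> S"
    using \<open>open S\<close> r(1) assms(2) open_contains_cball by (metis subsetD)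
  have "l - e \<in> S" "r + e' \<in> S"
    using e e' by (auto simp: subset_iff dist_real_def)
  then have "{l - e..r + e'} \<subseteq> S"
    using mem_is_interval_1_I[OF \<open>is_interval S\<close>] by (meson atLeastAtMost_iff subsetI)
  moreover have "K \<subseteq> {l - e<..<r + e'}"
    using l r e e' by force
  moreover have "l - e \<le> r + e'"
    using l(2)[OF r(1)] e e' by linarith
  ultimately show thesis using that by blast
qed

lemma test_functionD:
  assumes "test_function_on S \<phi>"
  shows "(\<phi> has_real_derivative deriv \<phi> x) (at x)" "continuous_on A (deriv \<phi>)"
    "\<exists>K. compact K \<and> K \<subseteq> S \<and> (\<forall>x. x \<notin> K \<longrightarrow> \<phi> x = 0 \<and> deriv \<phi> x = 0)"
proof -
  have d: "((deriv ^^ n) \<phi>) differentiable_on UNIV" for n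
    using assms by (auto simp: test_function_on_def)
  show "(\<phi> has_real_derivative deriv \<phi> x) (at x)"
    using d[of 0] DERIV_deriv_iff_real_differentiable[of \<phi> x] by (simp add: differentiable_on_def)
  show "continuous_on A (deriv \<phi>)"
    using differentiable_imp_continuous_on[OF d[of 1]] by (auto intro: continuous_on_subset)
  obtain K where K: "compact K" "K \<subseteq> S" "\<And>x. x \<notin> K \<Longrightarrow> \<phi> x = 0"
    using assms by (auto simp: test_function_on_def)
  have "deriv \<phi> x = 0" if "x \<notin> K" for x
  proof -
    have "((\<lambda>x. 0 :: real) has_real_derivative 0) (at x)" by simp
    then have "(\<phi> has_real_derivative 0) (at x)"
      by (rule has_field_derivative_transform_within_open[where S="- K"])
         (use K that compact_imp_closed in auto)
    then show ?thesis by (rule DERIV_imp_deriv)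
  qed
  then show "\<exists>K. compact K \<and> K \<subseteq> S \<and> (\<forall>x. x \<notin> K \<longrightarrow> \<phi> x = 0 \<and> deriv \<phi> x = 0)"
    using K by blast
qed

lemma test_function_supportE:
  assumes "test_function_on S \<phi>" "open S" "is_interval S" "S \<noteq> {}"
  obtains a b where "a \<le> b" "{a..b} \<subseteq> S" "\<And>x. x \<notin> {a<..<b} \<Longrightarrow> \<phi> x = 0" "\<And>x. x \<notin> {a<..<b} \<Longrightarrow> deriv \<phi> x = 0"
proof -
  obtain K where K: "compact K" "K \<subseteq> S" "\<And>x. x \<notin> K \<Longrightarrow> \<phi> x = 0 \<and> deriv \<phi> x = 0"
    using test_functionD(3)[OF assms(1)] by blast
  obtain x0 where "x0 \<in> S" using assms by blast
  \<comment> \<open>Adding \<open>x0\<close> keeps the compact set nonempty, also for a test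
    function that vanishes identically.\<close>
  then obtain a b where "a \<le> b" "{a..b} \<subseteq> S" "insert x0 K \<subseteq> {a<..<b}"
    using K assms by (rule_tac compact_subset_open_intervalE[of "insert x0 K" S]) auto
  then show thesis using that[of a b] K(3) by blast
qed

text \<open>The finite exceptional set \<open>N\<close> accommodates the jump of the source term at
  the first zero of a solution and the corner at the origin of an even extension.\<close>

lemma indefinite_integral_of_derivative:
  assumes "continuous_on {a..b} F" "finite N"
    and "\<And>x. x \<in> {a<..<b} - N \<Longrightarrow> (F has_real_derivative f x) (at x)"
    and "set_integrable lebesgue {a..b} f"
  shows "indefinite_integral_of F f a b"
  unfolding indefinite_integral_of_def
proof (intro conjI assms allI impI)
  fix x y assume xy: "a \<le> x" "x \<le> y" "y \<le> b"
  have "(f has_integral (F y - F x)) {x..y}"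
  proof (rule fundamental_theorem_of_calculus_interior_strong[OF assms(2) xy(2)])
    show "(F has_vector_derivative f z) (at z)" if "z \<in> {x<..<y} - N" for z
      using assms(3)[of z] that xy by (simp add: has_real_derivative_iff_has_vector_derivative)
    show "continuous_on {x..y} F"
      by (rule continuous_on_subset[OF assms(1)]) (use xy in auto)
  qed
  then show "F y - F x = integral {x..y} f" by (simp add: integral_unique)
qed

text \<open>Integration by parts against the test function on an interval whose end points lie off
  the support, so that the boundary terms vanish.\<close>

lemma has_weak_derivative_onI:
  assumes S: "open S" "is_interval S" "S \<noteq> {}"
    and F: "\<And>a b. a \<le> b \<Longrightarrow> {a..b} \<subseteq> S \<Longrightarrow> indefinite_integral_of F f a b"
  shows "has_weak_derivative_on F f S"
  unfolding has_weak_derivative_on_def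
proof (intro conjI allI impI)
  have Fi: "set_integrable lebesgue {a..b} F" if "a \<le> b" "{a..b} \<subseteq> S" for a b
    by (intro absolutely_integrable_continuous_real indefinite_integral_of_continuous_on[OF F] that)
  have loc: "locally_integrable_on S h" if "\<And>a b. a \<le> b \<Longrightarrow> {a..b} \<subseteq> S \<Longrightarrow> set_integrable lebesgue {a..b} h" for h
    unfolding locally_integrable_on_def
  proof (intro allI impI)
    fix K assume K: "compact K \<and> K \<subseteq> S"
    show "set_integrable lebesgue K h"
    proof (cases "K = {}")
      case False
      then obtain a b where "a \<le> b" "{a..b} \<subseteq> S" "K \<subseteq> {a<..<b}"
        using compact_subset_open_intervalE[of K S] K S by metis
      then show ?thesis
        using K by (intro set_integrable_subset[OF that[of a b]]) (auto intro: lmeasurable_compact fmeasurableD)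
    qed auto
  qed
  show "locally_integrable_on S F" by (intro loc Fi)
  show "locally_integrable_on S f" by (intro loc indefinite_integral_ofD(1)[OF F])
  fix \<phi> assume \<phi>: "test_function_on S \<phi>"
  note \<phi>D = test_functionD[OF \<phi>]
  obtain a b where ab: "a \<le> b" "{a..b} \<subseteq> S" and
    z: "\<And>x. x \<notin> {a<..<b} \<Longrightarrow> \<phi> x = 0" "\<And>x. x \<notin> {a<..<b} \<Longrightarrow> deriv \<phi> x = 0"
    using test_function_supportE[OF \<phi> S] by metis
  have c\<phi>: "continuous_on {a..b} \<phi>"
    using \<phi>D(1) by (meson DERIV_continuous continuous_at_imp_continuous_on)
  have I: "indefinite_integral_of \<phi> (deriv \<phi>) a b"
    by (rule indefinite_integral_of_derivative[where N="{}"])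
       (auto intro!: \<phi>D absolutely_integrable_continuous_real c\<phi>)
  note fD = indefinite_integral_ofD(1)[OF F[OF ab]]
  have "(LINT x:S|lebesgue. F x * deriv \<phi> x) = integral {a..b} (\<lambda>x. F x * deriv \<phi> x)"
    by (rule set_integral_compact_support[OF ab(2) Fi[OF ab]]) (use \<phi>D z in auto)
  moreover have "(LINT x:S|lebesgue. f x * \<phi> x) = integral {a..b} (\<lambda>x. f x * \<phi> x)"
    by (rule set_integral_compact_support[OF ab(2) fD]) (use c\<phi> z in auto)
  moreover have "integral {a..b} (\<lambda>x. f x * \<phi> x + F x * deriv \<phi> x) = F b * \<phi> b - F a * \<phi> a"
    by (rule indefinite_integral_by_parts(2)[OF F[OF ab] I ab(1)])
  moreover have "integral {a..b} (\<lambda>x. f x * \<phi> x + F x * deriv \<phi> x)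
      = integral {a..b} (\<lambda>x. f x * \<phi> x) + integral {a..b} (\<lambda>x. F x * deriv \<phi> x)"
  proof (intro Henstock_Kurzweil_Integration.integral_add set_lebesgue_integral_eq_integral(1))
    show "set_integrable lebesgue {a..b} (\<lambda>x. f x * \<phi> x)"
      using set_integrable_continuous_mult[OF c\<phi> fD] by (simp add: mult.commute)
    show "set_integrable lebesgue {a..b} (\<lambda>x. F x * deriv \<phi> x)"
      using set_integrable_continuous_mult[OF \<phi>D(2) Fi[OF ab]] by (simp add: mult.commute)
  qed
  ultimately show "(LINT x:S|lebesgue. F x * deriv \<phi> x) = - (LINT x:S|lebesgue. f x * \<phi> x)"
    using z by simp
qed

text \<open>A primitive \<open>V\<close> of \<open>g\<close> has the same weak derivative as
  \<open>f\<close>, so \<open>f - V\<close> has a constant mean \<open>m\<close>, and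
  \<open>V + m\<close> is the representative. Agreement in integrals over intervals serves two later
  purposes: equality almost everywhere in general, and equality everywhere for continuous
  \<open>f\<close>.\<close>

lemma weak_derivative_representative:
  assumes S: "open S" "is_interval S" "S \<noteq> {}" and f: "has_weak_derivative_on f g S"
  obtains F where "\<And>a b. a \<le> b \<Longrightarrow> {a..b} \<subseteq> S \<Longrightarrow> indefinite_integral_of F g a b"
    "\<And>a b. a < b \<Longrightarrow> {a..b} \<subseteq> S \<Longrightarrow> integral {a..b} (\<lambda>x. f x - F x) = 0"
proof -
  obtain x0 where x0: "x0 \<in> S" using S by blast
  have gi: "set_integrable lebesgue {a..b} g" if "{a..b} \<subseteq> S" for a b
    using f that by (auto simp: has_weak_derivative_on_def locally_integrable_on_def)
  have fi: "set_integrable lebesgue {a..b} f" if "{a..b} \<subseteq> S" for a b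
    using f that by (auto simp: has_weak_derivative_on_def locally_integrable_on_def)
  have sub: "{a..b} \<subseteq> S" if "a \<in> S" "b \<in> S" for a b
    using mem_is_interval_1_I[OF S(2)] that by (meson atLeastAtMost_iff subsetI)
  have comb: "integral {a..b} g + integral {b..c} g = integral {a..c} g"
    if "a \<le> b" "b \<le> c" "a \<in> S" "c \<in> S" for a b c
    using that set_lebesgue_integral_eq_integral(1)[OF gi[OF sub[of a c]]]
    by (intro Henstock_Kurzweil_Integration.integral_combine) auto
  define V where "V x = (if x0 \<le> x then integral {x0..x} g else - integral {x..x0} g)" for x
  have V: "indefinite_integral_of V g a b" if "a \<le> b" "{a..b} \<subseteq> S" for a b
    unfolding indefinite_integral_of_def
  proof (intro conjI gi that allI impI)
    fix x y assume "a \<le> x" "x \<le> y" "y \<le> b"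
    then have "x \<in> S" "y \<in> S" using that by auto
    with \<open>x \<le> y\<close> show "V y - V x = integral {x..y} g"
      using comb[of x0 x y] comb[of x x0 y] comb[of x y x0] x0 by (auto simp: V_def)
  qed
  have Vw: "has_weak_derivative_on V g S"
    by (intro has_weak_derivative_onI S V)
  have Vi: "set_integrable lebesgue {a..b} V" if "{a..b} \<subseteq> S" for a b
    using Vw that by (auto simp: has_weak_derivative_on_def locally_integrable_on_def)
  have loc: "locally_integrable_on S (\<lambda>x. f x - V x)"
    using f Vw by (auto simp: has_weak_derivative_on_def locally_integrable_on_def)
  obtain m where m: "\<And>a b. a < b \<Longrightarrow> {a..b} \<subseteq> S \<Longrightarrow> integral {a..b} (\<lambda>x. f x - V x) = m * (b - a)"
  proof (rule ex_mean_of_weak_derivative_zero[OF S(2) loc])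
    fix \<phi> assume \<phi>: "test_function_on S \<phi>"
    obtain a b where ab: "a \<le> b" "{a..b} \<subseteq> S" and
      z: "\<And>x. x \<notin> {a<..<b} \<Longrightarrow> deriv \<phi> x = 0"
      using test_function_supportE[OF \<phi> S] by metis
    have i: "set_integrable lebesgue S (\<lambda>x. h x * deriv \<phi> x)" if "set_integrable lebesgue {a..b} h" for h
      by (rule set_integral_compact_support[OF ab(2) that]) (use test_functionD[OF \<phi>] z in auto)
    have "(LINT x:S|lebesgue. f x * deriv \<phi> x - V x * deriv \<phi> x)
       = (LINT x:S|lebesgue. f x * deriv \<phi> x) - (LINT x:S|lebesgue. V x * deriv \<phi> x)"
      by (intro set_integral_diff i fi Vi ab)
    also have "\<dots> = 0"
      using f Vw \<phi> by (simp add: has_weak_derivative_on_def)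
    finally show "(LINT x:S|lebesgue. (f x - V x) * deriv \<phi> x) = 0"
      by (simp add: left_diff_distrib)
  qed auto
  show thesis
  proof (rule that)
    fix a b :: real
    show "indefinite_integral_of (\<lambda>x. V x + m) g a b" if "a \<le> b" "{a..b} \<subseteq> S"
      using V[OF that] by (simp add: indefinite_integral_of_def)
    assume ab: "a < b" "{a..b} \<subseteq> S"
    have "integral {a..b} (\<lambda>x. (f x - V x) - m) = integral {a..b} (\<lambda>x. f x - V x) - integral {a..b} (\<lambda>x. m)"
      by (intro Henstock_Kurzweil_Integration.integral_diff set_lebesgue_integral_eq_integral(1)
          set_integral_diff(1) fi[OF ab(2)] Vi[OF ab(2)]) auto
    also have "\<dots> = 0" using m[OF ab] ab by simp
    finally show "integral {a..b} (\<lambda>x. f x - (V x + m)) = 0"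
      by (simp add: diff_diff_eq)
  qed
qed

text \<open>Lebesgue differentiation: at almost every point \<open>h\<close> is the limit of its
  right-hand averages, all of which are 0.\<close>

lemma AE_eq_0_of_interval_integrals:
  fixes h :: "real \<Rightarrow> real"
  assumes "\<And>a b. h integrable_on {a..b}" "\<And>a b. a < b \<Longrightarrow> integral {a..b} h = 0"
  shows "AE x in lebesgue. h x = 0"
proof -
  obtain N where N: "negligible N" "\<And>x e. \<lbrakk>x \<notin> N; 0 < e\<rbrakk> \<Longrightarrow>
     \<exists>d>0. \<forall>t. 0 < t \<and> t < d \<longrightarrow> norm (integral (cbox x (x + t *\<^sub>R One)) h /\<^sub>R t ^ DIM(real) - h x) < e"
    using integrable_ccontinuous_explicit[of h] assms(1) by (metis box_real(2))
  have "h x = 0" if "x \<notin> N" for x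
  proof (rule ccontr)
    assume "h x \<noteq> 0"
    with N(2)[OF that, of "\<bar>h x\<bar>"] obtain d where
      "d > 0" and d: "\<forall>t. 0 < t \<and> t < d \<longrightarrow> norm (integral {x..x + t} h / t - h x) < \<bar>h x\<bar>"
      by (auto simp: divide_inverse mult.commute)
    have "norm (integral {x..x + d / 2} h / (d / 2) - h x) < \<bar>h x\<bar>"
      by (rule d[rule_format]) (use \<open>d > 0\<close> in auto)
    then show False using assms(2)[of x "x + d / 2"] \<open>d > 0\<close> by simp
  qed
  then show ?thesis
    using N(1) AE_not_in[of N lebesgue] by (auto simp: negligible_iff_null_sets elim: eventually_mono)
qed

text \<open>The integral of \<open>f - F\<close> over initial intervals is constantly 0, and its
  derivative is the continuous function \<open>f - F\<close>. This applies to the flux of a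
  solution, which is continuous because the solution is continuously differentiable.\<close>

lemma continuous_weak_derivative:
  assumes S: "open S" "is_interval S" and f: "has_weak_derivative_on f g S" and cont: "continuous_on S f"
    and ab: "a \<le> b" "{a..b} \<subseteq> S"
  shows "indefinite_integral_of f g a b"
proof -
  have "S \<noteq> {}" using ab by auto
  then obtain F where F: "\<And>a b. a \<le> b \<Longrightarrow> {a..b} \<subseteq> S \<Longrightarrow> indefinite_integral_of F g a b"
    "\<And>a b. a < b \<Longrightarrow> {a..b} \<subseteq> S \<Longrightarrow> integral {a..b} (\<lambda>x. f x - F x) = 0"
    using weak_derivative_representative[OF S _ f] by metis
  \<comment> \<open>A larger interval makes \<open>a\<close> and \<open>b\<close> interior points,
    where two-sided derivatives are available.\<close>
  obtain a' b' where ab': "a' \<le> b'" "{a'..b'} \<subseteq> S" "{a..b} \<subseteq> {a'<..<b'}"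
    using compact_subset_open_intervalE[OF compact_Icc ab(2) S] ab(1) by (metis atLeastatMost_empty_iff)
  have c: "continuous_on {a'..b'} (\<lambda>x. f x - F x)"
    by (intro continuous_intros continuous_on_subset[OF cont] ab' indefinite_integral_of_continuous_on[OF F(1)])
  have eq: "f x = F x" if "x \<in> {a..b}" for x
  proof -
    have x: "x \<in> {a'<..<b'}" using that ab' by auto
    have "((\<lambda>x. integral {a'..x} (\<lambda>x. f x - F x)) has_real_derivative (f x - F x)) (at x within {a'..b'})"
      by (rule integral_has_real_derivative[OF c]) (use x in auto)
    then have "((\<lambda>x. integral {a'..x} (\<lambda>x. f x - F x)) has_real_derivative (f x - F x)) (at x)"
      using x by (subst (asm) at_within_interior) auto
    moreover have "((\<lambda>x. 0) has_real_derivative 0) (at x)" by simp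
    then have "((\<lambda>x. integral {a'..x} (\<lambda>x. f x - F x)) has_real_derivative 0) (at x)"
    proof (rule has_field_derivative_transform_within_open[where S="{a'<..<b'}"])
      show "0 = integral {a'..z} (\<lambda>x. f x - F x)" if "z \<in> {a'<..<b'}" for z
        using that ab' by (intro F(2)[symmetric]) auto
    qed (use x in auto)
    ultimately show ?thesis using DERIV_unique by fastforce
  qed
  show ?thesis
    using F(1)[OF ab] eq unfolding indefinite_integral_of_def by auto
qed

section \<open>The Gagliardo--Nirenberg inequality\<close>

text \<open>Young's inequality for the functions divided by their norms; if one norm is 0, the
  product vanishes almost everywhere.\<close>

lemma Hoelder_inequality:
  fixes f g :: "'a \<Rightarrow> real"
  assumes pq: "p > 1" "q > 1" "1 / p + 1 / q = 1"
    and nonneg: "\<And>x. f x \<ge> 0" "\<And>x. g x \<ge> 0"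
    and meas: "f \<in> borel_measurable M" "g \<in> borel_measurable M"
    and int: "integrable M (\<lambda>x. f x powr p)" "integrable M (\<lambda>x. g x powr q)"
  shows "integrable M (\<lambda>x. f x * g x)"
    "(LINT x|M. f x * g x) \<le> (LINT x|M. f x powr p) powr (1 / p) * (LINT x|M. g x powr q) powr (1 / q)"
proof -
  show i: "integrable M (\<lambda>x. f x * g x)"
  proof (rule Bochner_Integration.integrable_bound)
    show "integrable M (\<lambda>x. f x powr p / p + g x powr q / q)"
      using int by auto
    show "AE x in M. norm (f x * g x) \<le> norm (f x powr p / p + g x powr q / q)"
      using Youngs_inequality[OF pq] nonneg pq by (auto simp: abs_mult)
  qed (use meas in auto)
  define A where "A = (LINT x|M. f x powr p)"
  define B where "B = (LINT x|M. g x powr q)"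
  have AB: "A \<ge> 0" "B \<ge> 0" unfolding A_def B_def by auto
  show "(LINT x|M. f x * g x) \<le> A powr (1 / p) * B powr (1 / q)"
  proof (cases "A = 0 \<or> B = 0")
    case True
    have "AE x in M. f x * g x = 0"
    proof (cases "A = 0")
      case True
      then have "AE x in M. f x powr p = 0"
        unfolding A_def using int(1) by (subst (asm) integral_nonneg_eq_0_iff_AE) auto
      then show ?thesis by eventually_elim auto
    next
      case False
      then have "AE x in M. g x powr q = 0"
        using True unfolding B_def using int(2) by (subst (asm) integral_nonneg_eq_0_iff_AE) auto
      then show ?thesis by eventually_elim auto
    qed
    then have "(LINT x|M. f x * g x) = 0"
      by (rule integral_eq_zero_AE)
    then show ?thesis by simp
  next
    case False
    with AB have pos: "A > 0" "B > 0" by auto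
    define \<alpha> where "\<alpha> = A powr (1 / p)"
    define \<beta> where "\<beta> = B powr (1 / q)"
    have ab: "\<alpha> > 0" "\<beta> > 0" "\<alpha> powr p = A" "\<beta> powr q = B"
      using pos pq by (auto simp: \<alpha>_def \<beta>_def powr_powr)
    have "(f x * g x) / (\<alpha> * \<beta>) \<le> f x powr p / A / p + g x powr q / B / q" for x
      using Youngs_inequality[OF pq, of "f x / \<alpha>" "g x / \<beta>"] nonneg[of x] ab
      by (simp add: powr_divide)
    then have "(LINT x|M. (f x * g x) / (\<alpha> * \<beta>)) \<le> (LINT x|M. f x powr p / A / p + g x powr q / B / q)"
      using i int by (intro integral_mono) auto
    also have "\<dots> = (LINT x|M. f x powr p) / A / p + (LINT x|M. g x powr q) / B / q"
      using int by simp
    also have "\<dots> = 1" using pos pq unfolding A_def[symmetric] B_def[symmetric] by simp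
    finally show ?thesis using ab by (simp add: \<alpha>_def[symmetric] \<beta>_def[symmetric])
  qed
qed

lemma set_integral_lebesgue_le:
  fixes h :: "real \<Rightarrow> real"
  assumes "integrable lebesgue h" "\<And>x. h x \<ge> 0"
  shows "integral {a..b} h \<le> (LINT x|lebesgue. h x)"
proof -
  have i: "set_integrable lebesgue {a..b} h"
    unfolding set_integrable_def by (intro integrable_mult_indicator assms) auto
  have "integral {a..b} h = (LINT x:{a..b}|lebesgue. h x)"
    using set_lebesgue_integral_eq_integral(2)[OF i] by simp
  also have "\<dots> \<le> (LINT x|lebesgue. h x)"
    unfolding set_lebesgue_integral_def using i assms
    by (intro integral_mono) (auto simp: set_integrable_def indicator_def)
  finally show ?thesis .
qed

text \<open>Were \<open>h \<ge> c\<close> on an interval of length \<open>N\<close>, the total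
  integral would be at least \<open>c * N\<close>. This replaces decay at infinity: one point of
  small value on each side suffices.\<close>

lemma integrable_small_values:
  fixes h :: "real \<Rightarrow> real"
  assumes h: "integrable lebesgue h" "\<And>x. h x \<ge> 0" and "c > 0"
  shows "\<exists>a<x. h a < c" "\<exists>b>x. h b < c"
proof -
  obtain N :: nat where N: "(LINT x|lebesgue. h x) / c < real N"
    using reals_Archimedean2 by blast
  have *: "\<exists>t\<in>{y..y + real N}. h t < c" for y
  proof (rule ccontr)
    assume "\<not> ?thesis"
    then have le: "c \<le> h t" if "t \<in> {y..y + real N}" for t using that by force
    have i: "set_integrable lebesgue {y..y + real N} h"
      unfolding set_integrable_def by (intro integrable_mult_indicator h) auto
    have "c * real N = integral {y..y + real N} (\<lambda>t. c)" by simp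
    also have "\<dots> \<le> integral {y..y + real N} h"
      by (intro integral_le set_lebesgue_integral_eq_integral(1) i le) auto
    also have "\<dots> \<le> (LINT x|lebesgue. h x)"
      by (rule set_integral_lebesgue_le[OF h])
    finally show False using N \<open>c > 0\<close> by (simp add: field_simps)
  qed
  obtain t where "t \<in> {x - real N - 1..x - real N - 1 + real N}" "h t < c"
    using *[of "x - real N - 1"] by blast
  then show "\<exists>a<x. h a < c" by (intro exI[of _ t]) auto
  obtain t where "t \<in> {x + 1..x + 1 + real N}" "h t < c"
    using *[of "x + 1"] by blast
  then show "\<exists>b>x. h b < c" by (intro exI[of _ t]) auto
qed

text \<open>Reflection exchanges the end points, so a bound for powers from the left end also yields
  one from the right end.\<close>

lemma indefinite_integral_of_reflect:
  assumes "indefinite_integral_of F f a b"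
  shows "indefinite_integral_of (\<lambda>x. F (- x)) (\<lambda>x. - f (- x)) (- b) (- a)"
  unfolding indefinite_integral_of_def
proof (intro conjI allI impI)
  show "set_integrable lebesgue {- b..- a} (\<lambda>x. - f (- x))"
    using indefinite_integral_ofD(1)[OF assms] absolutely_integrable_reflect_real[where f=f and a=a and b=b]
      set_integrable_mult_right[of "- 1" lebesgue "{- b..- a}" "\<lambda>x. f (- x)"]
    by simp
  fix x y assume "- b \<le> x" "x \<le> y" "y \<le> - a"
  then show "F (- y) - F (- x) = integral {x..y} (\<lambda>x. - f (- x))"
    using indefinite_integral_ofD(2)[OF assms, of "- y" "- x"] Henstock_Kurzweil_Integration.integral_reflect_real[where a="- y" and b="- x" and f=f]
    by simp
qed

lemma indefinite_integral_powr_le':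
  assumes F: "indefinite_integral_of F f a b" and "a \<le> b" "s > 1"
  shows "\<bar>F a\<bar> powr s - \<bar>F b\<bar> powr s \<le> s * integral {a..b} (\<lambda>t. \<bar>F t\<bar> powr (s - 1) * \<bar>f t\<bar>)"
  using indefinite_integral_powr_le(2)[OF indefinite_integral_of_reflect[OF F], of s] assms
    Henstock_Kurzweil_Integration.integral_reflect_real[where a=a and b=b and f="\<lambda>t. \<bar>F t\<bar> powr (s - 1) * \<bar>f t\<bar>"]
  by simp

text \<open>The factor 2 arises from estimating the same value from a far point on the left and from
  one on the right, over disjoint halves of the line.\<close>

lemma two_powr_le_integral:
  assumes F: "\<And>a b. a \<le> b \<Longrightarrow> indefinite_integral_of F f a b" and "s > 1" "r > 0"
    and Fr: "integrable lebesgue (\<lambda>x. \<bar>F x\<bar> powr r)"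
    and Ff: "integrable lebesgue (\<lambda>x. \<bar>F x\<bar> powr (s - 1) * \<bar>f x\<bar>)"
  shows "2 * \<bar>F x\<bar> powr s \<le> s * (LINT x|lebesgue. \<bar>F x\<bar> powr (s - 1) * \<bar>f x\<bar>)"
proof (rule field_le_epsilon)
  fix e :: real assume "e > 0"
  \<comment> \<open>Chosen so that \<open>\<bar>F t\<bar> powr r < c\<close> forces the boundary
    term \<open>\<bar>F t\<bar> powr s\<close> below \<open>e / 2\<close>.\<close>
  define c where "c = (e / 2) powr (r / s)"
  have c: "c > 0" using \<open>e > 0\<close> by (simp add: c_def)
  have small: "\<bar>F t\<bar> powr s \<le> e / 2" if "\<bar>F t\<bar> powr r < c" for t
  proof -
    have "(\<bar>F t\<bar> powr r) powr (s / r) \<le> c powr (s / r)"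
      using that \<open>s > 1\<close> \<open>r > 0\<close> by (intro powr_mono2) auto
    then show ?thesis using \<open>s > 1\<close> \<open>r > 0\<close> \<open>e > 0\<close> by (simp add: c_def powr_powr)
  qed
  obtain a where a: "a < x" "\<bar>F a\<bar> powr r < c"
    using integrable_small_values(1)[OF Fr _ c] by auto
  obtain b where b: "x < b" "\<bar>F b\<bar> powr r < c"
    using integrable_small_values(2)[OF Fr _ c] by auto
  let ?h = "\<lambda>t. \<bar>F t\<bar> powr (s - 1) * \<bar>f t\<bar>"
  have "2 * \<bar>F x\<bar> powr s \<le> s * (integral {a..x} ?h + integral {x..b} ?h) + e"
    using indefinite_integral_powr_le(2)[OF F, of a x s] indefinite_integral_powr_le'[OF F, of x b s]
      small[OF a(2)] small[OF b(2)] a b \<open>s > 1\<close> by (simp add: algebra_simps)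
  also have "integral {a..x} ?h + integral {x..b} ?h = integral {a..b} ?h"
    using a b \<open>s > 1\<close>
    by (intro Henstock_Kurzweil_Integration.integral_combine set_lebesgue_integral_eq_integral(1)
        indefinite_integral_powr_le(1) F) auto
  also have "s * integral {a..b} ?h \<le> s * (LINT x|lebesgue. ?h x)"
    using \<open>s > 1\<close> by (intro mult_left_mono set_integral_lebesgue_le Ff) auto
  finally show "2 * \<bar>F x\<bar> powr s \<le> s * (LINT x|lebesgue. ?h x) + e" by simp
qed

lemma GN_inequality_holds:
  assumes "p > 1" "q \<ge> 0"
  shows "GN_inequality p q (((p + (p - 1) * (q + 1)) / (2 * p)) powr (p / (p + (p - 1) * (q + 1))))"
  unfolding GN_inequality_def
proof (intro allI impI, elim conjE)
  fix u v
  assume u: "in_Lp (q + 1) u" and uv: "has_weak_derivative_on u v UNIV" and v: "in_Lp p v"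
  define s where "s = 1 + (q + 1) * (p - 1) / p"
  have s: "s > 1" using assms by (simp add: s_def)
  have sp: "s = (p + (p - 1) * (q + 1)) / p" using assms by (simp add: s_def field_simps)
  have th: "GN_theta p q = 1 / s" "p / (p + (p - 1) * (q + 1)) = 1 / s"
    "(p + (p - 1) * (q + 1)) / (2 * p) = s / 2"
    using assms by (auto simp: GN_theta_def sp)
  define p' where "p' = p / (p - 1)"
  have p': "p' > 1" "1 / p' + 1 / p = 1" "1 / p' = (p - 1) / p" "(s - 1) * p' = q + 1"
    using assms by (auto simp: p'_def s_def field_simps)
  obtain F where F: "\<And>a b. a \<le> b \<Longrightarrow> indefinite_integral_of F v a b"
    and uF: "\<And>a b. a < b \<Longrightarrow> integral {a..b} (\<lambda>x. u x - F x) = 0"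
    using weak_derivative_representative[OF _ _ _ uv] by auto
  have um: "u \<in> borel_measurable lebesgue" and ui: "integrable lebesgue (\<lambda>x. \<bar>u x\<bar> powr (q + 1))"
    using u by (auto simp: in_Lp_def)
  have vm: "v \<in> borel_measurable lebesgue" and vi: "integrable lebesgue (\<lambda>x. \<bar>v x\<bar> powr p)"
    using v by (auto simp: in_Lp_def)
  \<comment> \<open>The pointwise estimates concern \<open>F\<close>; equality almost everywhere
    transfers the integrals and the essential supremum to \<open>u\<close>.\<close>
  have "AE x in lebesgue. u x - F x = 0"
  proof (rule AE_eq_0_of_interval_integrals[OF _ uF])
    fix a b :: real
    have u: "u integrable_on {a..b}"
      using uv unfolding has_weak_derivative_on_def locally_integrable_on_def
      by (meson compact_Icc set_lebesgue_integral_eq_integral(1) subset_UNIV)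
    have "F integrable_on {a..b}"
    proof (cases "a \<le> b")
      case True
      then show ?thesis
        by (intro integrable_continuous_real indefinite_integral_of_continuous_on[OF F])
    qed auto
    with u show "(\<lambda>x. u x - F x) integrable_on {a..b}"
      by (rule integrable_diff)
  qed
  then have ae: "AE x in lebesgue. u x = F x" by simp
  have Fm: "F \<in> borel_measurable lebesgue"
    using borel_measurable_AE[OF um ae] .
  define I where "I = (LINT x|lebesgue. \<bar>u x\<bar> powr (q + 1))"
  define J where "J = (LINT x|lebesgue. \<bar>v x\<bar> powr p)"
  have ae': "AE x in lebesgue. \<bar>u x\<bar> powr (q + 1) = \<bar>F x\<bar> powr (q + 1)"
    using ae by eventually_elim simp
  have Fi: "integrable lebesgue (\<lambda>x. \<bar>F x\<bar> powr (q + 1))"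
    by (rule integrable_cong_AE_imp[OF ui _ ae']) (use Fm in measurable)
  have FI: "(LINT x|lebesgue. \<bar>F x\<bar> powr (q + 1)) = I"
    unfolding I_def by (rule integral_cong_AE[OF _ _ ae', symmetric]) (use Fm um in measurable)
  have pw: "(\<bar>F x\<bar> powr (s - 1)) powr p' = \<bar>F x\<bar> powr (q + 1)" for x
    by (simp add: powr_powr p')
  have H: "integrable lebesgue (\<lambda>x. \<bar>F x\<bar> powr (s - 1) * \<bar>v x\<bar>)"
    "(LINT x|lebesgue. \<bar>F x\<bar> powr (s - 1) * \<bar>v x\<bar>) \<le> I powr (1 / p') * J powr (1 / p)"
    using Hoelder_inequality[OF p'(1) assms(1) p'(2), of "\<lambda>x. \<bar>F x\<bar> powr (s - 1)" "\<lambda>x. \<bar>v x\<bar>" lebesgue]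
      Fi vi Fm vm
    by (simp_all add: pw FI flip: J_def)
  define C where "C = (s / 2) powr (1 / s) * Lp_norm (q + 1) u powr (1 - 1 / s) * Lp_norm p v powr (1 / s)"
  have IJ: "I \<ge> 0" "J \<ge> 0" by (auto simp: I_def J_def)
  \<comment> \<open>The root of order \<open>s\<close> turns the powers of \<open>I\<close> and
    \<open>J\<close> into those of the norms: \<open>(s - 1) * p' = q + 1\<close> makes the
    exponents of \<open>I\<close> agree.\<close>
  have C: "C = (s / 2 * (I powr (1 / p') * J powr (1 / p))) powr (1 / s)"
  proof -
    have e: "(1 - 1 / s) / (q + 1) = 1 / p' * (1 / s)"
    proof -
      have "1 - 1 / s = (s - 1) / s" using s by (simp add: field_simps)
      also have "s - 1 = (q + 1) / p'" using p' by (simp add: field_simps)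
      finally show ?thesis using assms by simp
    qed
    have "(s / 2 * (I powr (1 / p') * J powr (1 / p))) powr (1 / s)
        = (s / 2) powr (1 / s) * ((I powr (1 / p')) powr (1 / s) * (J powr (1 / p)) powr (1 / s))"
      using s by (simp only: powr_mult)
    then show ?thesis
      unfolding C_def Lp_norm_def I_def[symmetric] J_def[symmetric]
      using IJ s e by (simp add: powr_powr)
  qed
  have "\<bar>F x\<bar> \<le> C" for x
  proof -
    have "2 * \<bar>F x\<bar> powr s \<le> s * (LINT x|lebesgue. \<bar>F x\<bar> powr (s - 1) * \<bar>v x\<bar>)"
      by (rule two_powr_le_integral[OF F s _ Fi H(1)]) (use assms in auto)
    also have "\<dots> \<le> s * (I powr (1 / p') * J powr (1 / p))"
      using s H by (intro mult_left_mono) auto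
    finally have "(\<bar>F x\<bar> powr s) powr (1 / s) \<le> C"
      unfolding C using s by (intro powr_mono2) auto
    then show ?thesis using s by (simp add: powr_powr)
  qed
  then have "AE x in lebesgue. ereal \<bar>u x\<bar> \<le> ereal C"
    using ae by (auto elim: eventually_mono)
  then have "Linf_norm u \<le> ereal C"
    unfolding Linf_norm_def using um by (intro esssup_I) auto
  then show "Linf_norm u \<le> ereal (((p + (p - 1) * (q + 1)) / (2 * p)) powr (p / (p + (p - 1) * (q + 1)))
      * Lp_norm (q + 1) u powr (1 - GN_theta p q) * Lp_norm p v powr GN_theta p q)"
    unfolding th C_def .
qed

section \<open>Reduction to a first-order equation\<close>

text \<open>The factor obtained by solving the zero-energy relation
  \<open>(p - 1) / p * y powr p = u powr (q + 1) / (q + 1)\<close> for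
  \<open>y = - u'\<close>.\<close>

definition slope_const :: "real \<Rightarrow> real \<Rightarrow> real" where
  "slope_const p q = (p / ((p - 1) * (q + 1))) powr (1 / p)"

definition is_profile :: "real \<Rightarrow> real \<Rightarrow> (real \<Rightarrow> real) \<Rightarrow> bool" where
  "is_profile p q u \<longleftrightarrow>
     (\<forall>r>0. 0 \<le> u r \<and> (u has_real_derivative - slope_const p q * u r powr ((q + 1) / p)) (at r)) \<and>
     (u \<longlongrightarrow> 1) (at_right 0) \<and> (u \<longlongrightarrow> 0) at_top"

text \<open>At most one point; there \<open>u\<^sup>q\<close> jumps if \<open>q = 0\<close>, so it has to be left out when differentiating the flux
  \<open>\<bar>u'\<bar>\<^sup>p\<^sup>-\<^sup>2 u'\<close>.\<close>

definition first_zeros :: "(real \<Rightarrow> real) \<Rightarrow> real set" where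
  "first_zeros u = {r. 0 < r \<and> u r = 0 \<and> (\<forall>s. 0 < s \<and> s < r \<longrightarrow> u s \<noteq> 0)}"

lemma finite_first_zeros: "finite (first_zeros u)"
proof (cases "first_zeros u = {}")
  case False
  then obtain r where r: "r \<in> first_zeros u" by blast
  have "first_zeros u \<subseteq> {r}"
    using r by (auto simp: first_zeros_def) (metis linorder_neqE_linordered_idom)
  then show ?thesis by (rule finite_subset) simp
qed simp

text \<open>A zero that is not the first has an earlier zero, after which a nonnegative
  nonincreasing function stays at 0. Hence \<open>u\<close> vanishes on a whole neighbourhood of
  \<open>r\<close>.\<close>

lemma eventually_zero_of_antimono:
  assumes "antimono_on {0<..} u" "\<And>r. r > 0 \<Longrightarrow> (0::real) \<le> u r" "r > 0" "u r = 0" "r \<notin> first_zeros u"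
  obtains s where "0 < s" "s < r" "\<And>t. s \<le> t \<Longrightarrow> u t = 0"
proof -
  obtain s where s: "0 < s" "s < r" "u s = 0"
    using assms by (auto simp: first_zeros_def)
  have "u t = 0" if "s \<le> t" for t
    using monotone_onD[OF assms(1), of s t] assms(2)[of t] s that by auto
  with s show thesis using that by blast
qed

text \<open>Where \<open>u > 0\<close> the source term is continuous, and this makes the weak
  equation for the flux a classical one.\<close>

lemma indefinite_integral_has_real_derivative:
  assumes W: "\<And>a b. 0 < a \<Longrightarrow> a \<le> b \<Longrightarrow> indefinite_integral_of W g a b" and "r > 0" "isCont g r"
  shows "(W has_real_derivative g r) (at r)"
proof -
  have "((\<lambda>x. integral {r / 2..x} g) has_vector_derivative g r) (at r within {r / 2..r + 1} - {})"
  proof (rule integral_has_vector_derivative_continuous_at)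
    show "g integrable_on {r / 2..r + 1}"
      by (rule indefinite_integral_ofD(4)[OF W[of "r / 2" "r + 1"]]) (use \<open>r > 0\<close> in auto)
  qed (use assms in \<open>auto intro: continuous_at_imp_continuous_at_within\<close>)
  moreover have "at r within {r / 2..r + 1} - {} = at r"
    by (rule at_within_interior) (use \<open>r > 0\<close> in auto)
  ultimately have "((\<lambda>x. integral {r / 2..x} g) has_real_derivative g r) (at r)"
    by (simp only: has_real_derivative_iff_has_vector_derivative)
  then have "((\<lambda>x. W (r / 2) + integral {r / 2..x} g) has_real_derivative g r) (at r)"
    by (auto intro!: derivative_eq_intros)
  then show ?thesis
  proof (rule has_field_derivative_transform_within_open[where S="{r / 2<..<r + 1}"])
    show "W (r / 2) + integral {r / 2..x} g = W x" if "x \<in> {r / 2<..<r + 1}" for x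
      using indefinite_integral_ofD(2)[OF W[of "r / 2" "r + 1"], of "r / 2" x] that \<open>r > 0\<close> by auto
  qed (use \<open>r > 0\<close> in auto)
qed

lemma derivative_nonpos_of_antimono:
  assumes "antimono_on {0<..} (u :: real \<Rightarrow> real)" "r > 0" "(u has_real_derivative D) (at r)"
  shows "D \<le> 0"
proof (rule ccontr)
  assume "\<not> D \<le> 0"
  then obtain d where d: "d > 0" "\<And>h. h > 0 \<Longrightarrow> h < d \<Longrightarrow> u r < u (r + h)"
    using DERIV_pos_inc_right[OF assms(3)] by auto
  have "u (r + d / 2) \<le> u r"
    using monotone_onD[OF assms(1), of r "r + d / 2"] assms(2) d(1) by auto
  with d(2)[of "d / 2"] d(1) show False by simp
qed

lemma tendsto_zero_of_antimono_derivative: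
  fixes u y :: "real \<Rightarrow> real"
  assumes nonneg: "\<And>r. r > 0 \<Longrightarrow> 0 \<le> u r" "\<And>r. r > 0 \<Longrightarrow> 0 \<le> y r"
    and deriv: "\<And>r. r > 0 \<Longrightarrow> (u has_real_derivative - y r) (at r)"
    and anti: "\<And>a b. 0 < a \<Longrightarrow> a \<le> b \<Longrightarrow> y b \<le> y a"
  shows "(y \<longlongrightarrow> 0) at_top"
proof (rule order_tendstoI)
  show "eventually (\<lambda>r. e < y r) at_top" if "e < 0" for e
    using eventually_gt_at_top[of 0] by eventually_elim (use nonneg(2) that in force)
  fix e :: real assume "0 < e"
  have "\<exists>r>0. y r < e"
  proof (rule ccontr)
    assume "\<not> ?thesis"
    then have ye: "y r \<ge> e" if "r > 0" for r using that by force
    \<comment> \<open>With this \<open>b\<close>, a descent at rate at least \<open>e\<close> from 1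
      to \<open>b\<close> amounts to at least \<open>u 1 + e\<close>, which would make
      \<open>u b\<close> negative.\<close>
    define b where "b = u 1 / e + 2"
    have "0 \<le> u 1 / e" using nonneg(1)[of 1] \<open>0 < e\<close> by simp
    then have b: "b > 1" unfolding b_def by linarith
    obtain z where z: "1 < z" "z < b" "u b - u 1 = (b - 1) * (- y z)"
      using MVT2[OF b, of u "\<lambda>r. - y r"] deriv by force
    have "(b - 1) * e \<le> (b - 1) * y z"
      using ye[of z] z b by (intro mult_left_mono) auto
    moreover have "(b - 1) * e = u 1 + e" using \<open>0 < e\<close> by (simp add: b_def field_simps)
    ultimately have "u b < 0" using z \<open>0 < e\<close> by simp
    with nonneg(1)[of b] b show False by simp
  qed
  then obtain r where r: "r > 0" "y r < e" by blast
  show "eventually (\<lambda>r. y r < e) at_top"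
    using eventually_ge_at_top[of r] by eventually_elim (use anti r in force)
qed

lemma solution_imp_profile:
  assumes pq: "p > 1" "q \<ge> 0" and sol: "is_solution p q u"
  shows "is_profile p q u"
proof -
  have nonneg: "0 \<le> u r" if "r > 0" for r using sol that by (auto simp: is_solution_def)
  have anti: "antimono_on {0<..} u" using sol by (auto simp: is_solution_def)
  have lim: "(u \<longlongrightarrow> 1) (at_right 0)" "(u \<longlongrightarrow> 0) at_top" using sol by (auto simp: is_solution_def)
  obtain D where D: "\<And>r. r > 0 \<Longrightarrow> (u has_real_derivative D r) (at r)" and Dc: "continuous_on {0<..} D"
    using sol unfolding is_solution_def C1_differentiable_on_def
    by (auto simp: has_real_derivative_iff_has_vector_derivative)
  define y where "y r = - D r" for r
  have y0: "y r \<ge> 0" if "r > 0" for r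
    using derivative_nonpos_of_antimono[OF anti that D[OF that]] by (simp add: y_def)
  have yD: "(u has_real_derivative - y r) (at r)" if "r > 0" for r
    using D[OF that] by (simp add: y_def)
  have yc: "continuous_on {0<..} y" unfolding y_def by (intro continuous_intros Dc)
  define g where "g r = u r powr q" for r
  define W where "W r = \<bar>deriv u r\<bar> powr (p - 2) * deriv u r" for r
  have Wy: "W r = - (y r powr (p - 1))" if "r > 0" for r
  proof -
    have "y r powr (p - 2) * y r = y r powr (p - 1)"
      using y0[OF that] powr_mult_base[of "y r" "p - 2"] by (simp add: mult.commute)
    then show ?thesis
      using DERIV_imp_deriv[OF yD[OF that]] y0[OF that] by (simp add: W_def)
  qed
  have Wc: "continuous_on {0<..} W"
  proof (rule continuous_on_eq)
    show "continuous_on {0<..} (\<lambda>r. - (y r powr (p - 1)))"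
      by (intro continuous_intros continuous_on_powr' yc) (use y0 pq in auto)
  qed (use Wy in auto)
  have Ww: "has_weak_derivative_on W g {0<..}"
    using sol unfolding is_solution_def W_def[abs_def] g_def[abs_def] by blast
  have W: "indefinite_integral_of W g a b" if "0 < a" "a \<le> b" for a b
    by (rule continuous_weak_derivative[OF _ _ Ww Wc that(2)]) (use that in auto)
  \<comment> \<open>The flux is nondecreasing because its density is nonnegative, and
    \<open>y powr (p - 1)\<close> is the flux with the sign changed.\<close>
  have yanti: "y b \<le> y a" if "0 < a" "a \<le> b" for a b
  proof -
    have "W b - W a = integral {a..b} g"
      using indefinite_integral_ofD(2)[OF W[OF that]] that by auto
    also have "\<dots> \<ge> 0"
      using indefinite_integral_ofD(4)[OF W[OF that]] by (intro integral_nonneg) (auto simp: g_def)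
    finally have "y b powr (p - 1) \<le> y a powr (p - 1)" using Wy that by simp
    then show ?thesis
      using powr_less_mono2[of "p - 1" "y a" "y b"] y0[of a] that pq by (meson diff_gt_0_iff_gt not_less)
  qed
  have ylim: "(y \<longlongrightarrow> 0) at_top"
    by (rule tendsto_zero_of_antimono_derivative[OF nonneg y0 yD yanti])
  define E where "E r = (p - 1) / p * y r powr p - u r powr (q + 1) / (q + 1)" for r
  have uc: "continuous_on {0<..} u"
    using yD by (meson DERIV_continuous continuous_at_imp_continuous_on greaterThan_iff)
  have Ec: "continuous_on {0<..} E"
    unfolding E_def by (intro continuous_intros continuous_on_powr' yc uc) (use y0 nonneg pq in auto)
  have Elim: "(E \<longlongrightarrow> 0) at_top"
  proof -
    have ev: "eventually (\<lambda>r. 0 \<le> y r) at_top" "eventually (\<lambda>r. 0 \<le> u r) at_top"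
      using eventually_gt_at_top[of 0] by (eventually_elim, use y0 nonneg in auto)+
    have "((\<lambda>r. (p - 1) / p * y r powr p - u r powr (q + 1) / (q + 1)) \<longlongrightarrow>
        (p - 1) / p * 0 powr p - 0 powr (q + 1) / (q + 1)) at_top"
      using pq by (intro tendsto_intros tendsto_powr' ylim lim) (auto simp: ev)
    then show ?thesis by (simp add: E_def[abs_def])
  qed
  have Ed: "(E has_real_derivative 0) (at r)" if r: "r > 0" "r \<notin> first_zeros u" for r
  proof (cases "u r = 0")
    case True
    then obtain s where s: "0 < s" "s < r" "\<And>t. s \<le> t \<Longrightarrow> u t = 0"
      using eventually_zero_of_antimono[OF anti nonneg r(1) _ r(2)] by blast
    have y: "y t = 0" if "t > s" for t
    proof -
      have "((\<lambda>t. 0 :: real) has_real_derivative 0) (at t)" by simp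
      then have "(u has_real_derivative 0) (at t)"
        by (rule has_field_derivative_transform_within_open[where S="{s<..}"]) (use s that in auto)
      with yD[of t] s that show ?thesis using DERIV_unique by force
    qed
    have "((\<lambda>t. 0 :: real) has_real_derivative 0) (at r)" by simp
    then show ?thesis
      by (rule has_field_derivative_transform_within_open[where S="{s<..}"]) (use s y pq in \<open>auto simp: E_def\<close>)
  next
    case False
    then have u: "u r > 0" using nonneg[OF r(1)] by simp
    have "isCont g r"
      unfolding g_def using u DERIV_isCont[OF yD[OF r(1)]] by (intro continuous_intros) auto
    then have Wd: "(W has_real_derivative g r) (at r)"
      using indefinite_integral_has_real_derivative[OF W r(1)] by blast
    \<comment> \<open>The flux is nonpositive on the half line and strictly increasing at
      \<open>r\<close>, hence negative at \<open>r\<close>. This gives the power of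
      \<open>- W\<close> below a positive base, as the chain rule requires.\<close>
    have "g r > 0" using u by (simp add: g_def)
    then obtain d where d: "d > 0" "\<And>h. h > 0 \<Longrightarrow> h < d \<Longrightarrow> W r < W (r + h)"
      using DERIV_pos_inc_right[OF Wd] by auto
    have "W r < W (r + d / 2)" using d by simp
    also have "\<dots> \<le> 0" using Wy[of "r + d / 2"] r d by simp
    finally have Wneg: "W r < 0" .
    have yW: "y t powr p = (- W t) powr (p / (p - 1))" if "t > 0" for t
      using Wy[OF that] pq by (simp add: powr_powr)
    have yW1: "(- W r) powr (p / (p - 1) - 1) = y r"
    proof -
      have "p / (p - 1) - 1 = 1 / (p - 1)" using pq by (simp add: field_simps)
      then show ?thesis using Wy[OF r(1)] pq y0[OF r(1)] by (simp add: powr_powr)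
    qed
    have "((\<lambda>t. (p - 1) / p * (- W t) powr (p / (p - 1)) - u t powr (q + 1) / (q + 1)) has_real_derivative
       (p - 1) / p * (p / (p - 1) * (- W r) powr (p / (p - 1) - 1) * (- g r)) -
       ((q + 1) * u r powr (q + 1 - 1) * (- y r)) / (q + 1)) (at r)"
      using Wneg u by (intro DERIV_diff DERIV_cmult DERIV_cdivide DERIV_chain2[OF has_real_derivative_powr]
        DERIV_minus Wd yD r) auto
    also have "(p - 1) / p * (p / (p - 1) * (- W r) powr (p / (p - 1) - 1) * (- g r)) -
       ((q + 1) * u r powr (q + 1 - 1) * (- y r)) / (q + 1) = 0"
      unfolding yW1 using pq by (simp add: g_def field_simps)
    finally show ?thesis
      by (rule has_field_derivative_transform_within_open[where S="{0<..}"]) (use r yW in \<open>auto simp: E_def\<close>)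
  qed
  have E0: "E r = 0" if "r > 0" for r
  proof -
    \<comment> \<open>Continuity of \<open>E\<close> carries its value across the possible first
      zero; the limit at infinity then identifies the constant as 0.\<close>
    have const: "E x = E r" if "x > 0" for x
      by (rule has_derivative_zero_unique_strong_connected[of "{0<..}" "first_zeros u" E r])
         (use that \<open>r > 0\<close> Ec finite_first_zeros Ed in
           \<open>auto simp: has_field_derivative_def at_within_open[of _ "{0<..}"] lambda_zero\<close>)
    have "(E \<longlongrightarrow> E r) at_top"
      by (intro tendsto_eventually eventually_mono[OF eventually_gt_at_top[of 0]] const)
    then show ?thesis using tendsto_unique[OF _ _ Elim] by auto
  qed
  have "y r = slope_const p q * u r powr ((q + 1) / p)" if "r > 0" for r
  proof -
    have "y r powr p = p / (p - 1) * ((p - 1) / p * y r powr p)" using pq by simp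
    also have "(p - 1) / p * y r powr p = u r powr (q + 1) / (q + 1)"
      using E0[OF that] by (simp add: E_def)
    finally have "y r powr p = p / ((p - 1) * (q + 1)) * u r powr (q + 1)" by simp
    then have "(y r powr p) powr (1 / p) = (p / ((p - 1) * (q + 1)) * u r powr (q + 1)) powr (1 / p)"
      by simp
    then show ?thesis
      using pq y0[OF that] by (simp only: powr_mult powr_powr slope_const_def) simp
  qed
  then show ?thesis
    unfolding is_profile_def using yD nonneg lim by fastforce
qed


section \<open>From the first-order equation back to the weak formulation, and uniqueness\<close>

lemma profile_antimono:
  assumes "is_profile p q u"
  shows "antimono_on {0<..} u"
proof (rule monotone_onI)
  fix a b :: real assume ab: "a \<in> {0<..}" "b \<in> {0<..}" "a \<le> b"
  show "u b \<le> u a"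
  proof (rule DERIV_nonpos_imp_nonincreasing[OF ab(3)])
    fix x assume "a \<le> x" "x \<le> b"
    with ab assms show "\<exists>y. (u has_real_derivative y) (at x) \<and> y \<le> 0"
      by (intro exI[of _ "- slope_const p q * u x powr ((q + 1) / p)"]) (auto simp: is_profile_def slope_const_def)
  qed
qed

lemma slope_const_pos: "p > 1 \<Longrightarrow> q \<ge> 0 \<Longrightarrow> slope_const p q > 0"
  by (simp add: slope_const_def)

lemma slope_const_powr: "p > 1 \<Longrightarrow> q \<ge> 0 \<Longrightarrow> slope_const p q powr p = p / ((p - 1) * (q + 1))"
  by (simp add: slope_const_def powr_powr)

text \<open>Along \<open>u' = - k u\<^sup>m\<close> the flux is a multiple of a power of
  \<open>u\<close>. Its derivative carries the factor \<open>k powr p * (m * (p - 1)) = 1\<close>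
  and the exponent \<open>m * (p - 1) - 1 + m = q\<close>.\<close>

lemma profile_imp_solution:
  assumes pq: "p > 1" "q \<ge> 0" and prof: "is_profile p q u"
  shows "is_solution p q u"
proof -
  define k where "k = slope_const p q"
  have k: "k > 0" "k powr p = p / ((p - 1) * (q + 1))"
    using slope_const_pos[OF pq] slope_const_powr[OF pq] by (auto simp: k_def)
  define m where "m = (q + 1) / p"
  have m: "m > 0" "m * (p - 1) - 1 + m = q" using pq by (auto simp: m_def field_simps)
  have nonneg: "0 \<le> u r" and ud: "(u has_real_derivative - k * u r powr m) (at r)" if "r > 0" for r
    using prof that by (auto simp: is_profile_def k_def m_def)
  note anti = profile_antimono[OF prof]
  have uc: "continuous_on {0<..} u"
    using ud by (meson DERIV_continuous continuous_at_imp_continuous_on greaterThan_iff)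
  have C1: "u C1_differentiable_on {0<..}"
    unfolding C1_differentiable_on_def
  proof (intro exI conjI ballI)
    show "(u has_vector_derivative - k * u r powr m) (at r)" if "r \<in> {0<..}" for r
      using ud that by (simp add: has_real_derivative_iff_has_vector_derivative)
    show "continuous_on {0<..} (\<lambda>r. - k * u r powr m)"
      by (intro continuous_intros continuous_on_powr' uc) (use nonneg m in auto)
  qed
  define W where "W r = \<bar>deriv u r\<bar> powr (p - 2) * deriv u r" for r
  have W: "W r = - (k powr (p - 1) * u r powr (m * (p - 1)))" if "r > 0" for r
  proof -
    define y where "y = k * u r powr m"
    have y: "y \<ge> 0" using k nonneg[OF that] by (simp add: y_def)
    have "y powr (p - 2) * y = y powr (p - 1)"
      using y powr_mult_base[of y "p - 2"] by (simp add: mult.commute)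
    then show ?thesis
      using DERIV_imp_deriv[OF ud[OF that]] y by (simp add: W_def y_def powr_mult powr_powr)
  qed
  have Wc: "continuous_on {0<..} W"
  proof (rule continuous_on_eq)
    show "continuous_on {0<..} (\<lambda>r. - (k powr (p - 1) * u r powr (m * (p - 1))))"
      by (intro continuous_intros continuous_on_powr' uc) (use nonneg m pq in auto)
  qed (use W in auto)
  have Wd: "(W has_real_derivative u r powr q) (at r)" if r: "r > 0" "r \<notin> first_zeros u" for r
  proof (cases "u r = 0")
    case True
    then obtain s where s: "0 < s" "s < r" "\<And>t. s \<le> t \<Longrightarrow> u t = 0"
      using eventually_zero_of_antimono[OF anti nonneg r(1) _ r(2)] by blast
    have "((\<lambda>t. 0 :: real) has_real_derivative u r powr q) (at r)" using True by simp
    then show ?thesis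
      by (rule has_field_derivative_transform_within_open[where S="{s<..}"]) (use s W in auto)
  next
    case False
    \<comment> \<open>Positivity matters because the exponent \<open>m * (p - 1) - 1\<close> may be
      negative; for \<open>q = 0\<close> it is \<open>- 1 / p\<close>.\<close>
    then have u: "u r > 0" using nonneg[OF r(1)] by simp
    have "((\<lambda>t. - (k powr (p - 1) * u t powr (m * (p - 1)))) has_real_derivative
       - (k powr (p - 1) * (m * (p - 1) * u r powr (m * (p - 1) - 1) * (- k * u r powr m)))) (at r)"
      using u by (intro DERIV_minus DERIV_cmult DERIV_chain2[OF has_real_derivative_powr] ud r) auto
    also have "- (k powr (p - 1) * (m * (p - 1) * u r powr (m * (p - 1) - 1) * (- k * u r powr m)))
       = (k * k powr (p - 1)) * (m * (p - 1)) * (u r powr (m * (p - 1) - 1) * u r powr m)"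
      by simp
    also have "k * k powr (p - 1) = k powr p"
      using k powr_mult_base[of k "p - 1"] by simp
    also have "u r powr (m * (p - 1) - 1) * u r powr m = u r powr q"
      unfolding powr_add[symmetric] m(2) ..
    also have "k powr p * (m * (p - 1)) = 1"
      using pq by (simp add: k m_def)
    finally have "((\<lambda>t. - (k powr (p - 1) * u t powr (m * (p - 1)))) has_real_derivative u r powr q) (at r)"
      by simp
    then show ?thesis
      by (rule has_field_derivative_transform_within_open[where S="{0<..}"]) (use r W in auto)
  qed
  have "has_weak_derivative_on W (\<lambda>r. u r powr q) {0<..}"
  proof (rule has_weak_derivative_onI)
    fix a b :: real assume ab: "a \<le> b" "{a..b} \<subseteq> {0<..}"
    then have a: "a > 0" by auto
    show "indefinite_integral_of W (\<lambda>r. u r powr q) a b"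
    proof (rule indefinite_integral_of_derivative[OF _ finite_first_zeros])
      show "continuous_on {a..b} W" using Wc ab by (rule_tac continuous_on_subset)
      show "(W has_real_derivative u x powr q) (at x)" if "x \<in> {a<..<b} - first_zeros u" for x
        using that a by (intro Wd) auto
      \<comment> \<open>For \<open>q = 0\<close> the source may jump at the first zero, so
        integrability is derived from measurability and the bound by the value at \<open>a\<close>,
        not from continuity.\<close>
      have "(\<lambda>r. u r powr q * 1) absolutely_integrable_on {a..b}"
      proof (rule absolutely_integrable_bounded_measurable_product_real)
        have "u \<in> borel_measurable (lebesgue_on {a..b})"
          by (intro continuous_imp_measurable_on_sets_lebesgue continuous_on_subset[OF uc ab(2)]) auto
        then show "(\<lambda>r. u r powr q) \<in> borel_measurable (lebesgue_on {a..b})"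
          by measurable
        have "u r powr q \<le> u a powr q" if "r \<in> {a..b}" for r
          using monotone_onD[OF anti, of a r] that a nonneg[of r] pq by (intro powr_mono2) auto
        then show "bounded ((\<lambda>r. u r powr q) ` {a..b})"
          by (intro boundedI[where B="u a powr q"]) auto
      qed auto
      then show "set_integrable lebesgue {a..b} (\<lambda>r. u r powr q)" by simp
    qed
  qed auto
  then show ?thesis
    unfolding is_solution_def W_def[abs_def] using nonneg anti C1 prof by (auto simp: is_profile_def)
qed

text \<open>For \<open>q < p - 1\<close> the right-hand side is not Lipschitz at 0, so the usual
  uniqueness theorem fails there. Its monotonicity still gives uniqueness forward in
  \<open>r\<close>, starting from the common limit at 0.\<close>

lemma profile_unique:
  assumes pq: "p > 1" "q \<ge> 0" and u: "is_profile p q u" and U: "is_profile p q U" and "r > 0"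
  shows "u r = U r"
proof -
  define k where "k = slope_const p q"
  have k: "k > 0" using slope_const_pos[OF pq] by (simp add: k_def)
  define m where "m = (q + 1) / p"
  have m: "m > 0" using pq by (simp add: m_def)
  have u': "0 \<le> u r" "(u has_real_derivative - k * u r powr m) (at r)" if "r > 0" for r
    using u that by (auto simp: is_profile_def k_def m_def)
  have U': "0 \<le> U r" "(U has_real_derivative - k * U r powr m) (at r)" if "r > 0" for r
    using U that by (auto simp: is_profile_def k_def m_def)
  define d where "d r = (u r - U r)\<^sup>2" for r
  have dd: "\<exists>y. (d has_real_derivative y) (at r) \<and> y \<le> 0" if "r > 0" for r
  proof (intro exI conjI)
    show "(d has_real_derivative 2 * (u r - U r) * (- k * u r powr m - - k * U r powr m)) (at r)"
      unfolding d_def using u'(2)[OF that] U'(2)[OF that] by (auto intro!: derivative_eq_intros)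
    have "(u r - U r) * (u r powr m - U r powr m) \<ge> 0"
    proof (cases "u r \<le> U r")
      case True
      then have "u r powr m \<le> U r powr m" using u'[OF that] m by (intro powr_mono2) auto
      with True show ?thesis by (intro mult_nonpos_nonpos) auto
    next
      case False
      then have "U r powr m \<le> u r powr m" using U'[OF that] m by (intro powr_mono2) auto
      with False show ?thesis by (intro mult_nonneg_nonneg) auto
    qed
    then have "k * ((u r - U r) * (u r powr m - U r powr m)) \<ge> 0" using k by simp
    then show "2 * (u r - U r) * (- k * u r powr m - - k * U r powr m) \<le> 0"
      by (simp add: algebra_simps)
  qed
  have dec: "d r \<le> d t" if "0 < t" "t \<le> r" for t
    by (rule DERIV_nonpos_imp_nonincreasing[OF that(2)], rule dd) (use that in auto)
  have "(d \<longlongrightarrow> (1 - 1)\<^sup>2) (at_right 0)"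
    unfolding d_def using u U by (intro tendsto_intros) (auto simp: is_profile_def)
  moreover have "eventually (\<lambda>t. d r \<le> d t) (at_right 0)"
    using \<open>r > 0\<close> dec by (auto simp: eventually_at_right_field intro!: exI[of _ r])
  ultimately have "d r \<le> (1 - 1)\<^sup>2"
    by (intro tendsto_lowerbound) auto
  then show ?thesis by (simp add: d_def)
qed

lemma profile_cong:
  assumes "is_profile p q U" "\<And>r. r > 0 \<Longrightarrow> u r = U r"
  shows "is_profile p q u"
  unfolding is_profile_def
proof (intro conjI allI impI)
  fix r :: real assume r: "r > 0"
  show "0 \<le> u r" using assms r by (simp add: is_profile_def)
  have "(U has_real_derivative - slope_const p q * u r powr ((q + 1) / p)) (at r)"
    using assms r by (simp add: is_profile_def)
  then show "(u has_real_derivative - slope_const p q * u r powr ((q + 1) / p)) (at r)"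
    by (rule has_field_derivative_transform_within_open[where S="{0<..}"]) (use assms r in auto)
next
  have ev: "eventually (\<lambda>r. U r = u r) (at_right 0)" "eventually (\<lambda>r. U r = u r) at_top"
    using assms(2) by (auto simp: eventually_at_filter intro: eventually_mono[OF eventually_gt_at_top[of 0]])
  show "(u \<longlongrightarrow> 1) (at_right 0)"
    using assms(1) tendsto_cong[OF ev(1)] by (simp add: is_profile_def)
  show "(u \<longlongrightarrow> 0) at_top"
    using assms(1) tendsto_cong[OF ev(2)] by (simp add: is_profile_def)
qed

lemma solution_iff_eq_profile:
  assumes "p > 1" "q \<ge> 0" "is_profile p q U"
  shows "is_solution p q u \<longleftrightarrow> (\<forall>r>0. u r = U r)"
  using assms profile_unique profile_cong solution_imp_profile profile_imp_solution by metis

section \<open>Closed forms and the extremal function\<close>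

lemma slope_const_eq:
  assumes "p > 1" "q \<ge> 0"
  shows "slope_const p q = p powr (1 / p) / ((p - 1) powr (1 / p) * (q + 1) powr (1 / p))"
  unfolding slope_const_def by (simp add: powr_divide powr_mult)

lemma exp_profile:
  assumes "p > 1" "q = p - 1"
  shows "is_profile p q (\<lambda>r. exp (- ((p - 1) powr (- 1 / p)) * r))"
proof -
  have k: "slope_const p q = (p - 1) powr (- 1 / p)"
    using assms by (simp add: slope_const_def powr_divide powr_minus_divide)
  define k where "k = slope_const p q"
  have k0: "k > 0" using slope_const_pos[of p q] assms by (simp add: k_def)
  have m: "(q + 1) / p = 1" using assms by simp
  have "((\<lambda>r. exp (- k * r)) \<longlongrightarrow> exp (- k * 0)) (at_right 0)"
    by (intro tendsto_intros)
  moreover have "((\<lambda>r. exp (- k * r)) \<longlongrightarrow> 0) at_top"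
    using k0 by real_asymp
  moreover have "((\<lambda>r. exp (- k * r)) has_real_derivative - k * exp (- k * r)) (at r)" for r
    by (auto intro!: derivative_eq_intros)
  ultimately have "is_profile p q (\<lambda>r. exp (- k * r))"
    unfolding is_profile_def m k_def[symmetric] by simp
  then show ?thesis by (simp add: k_def k)
qed

text \<open>At 0 the difference quotient is at most \<open>\<bar>y\<bar> powr (n - 1)\<close>, which
  tends to 0 because \<open>n > 1\<close>. This makes the truncated power differentiable across the
  edge of its support.\<close>

lemma DERIV_max_0_powr:
  assumes "n > 1"
  shows "((\<lambda>x. max 0 x powr n) has_real_derivative n * max 0 x powr (n - 1)) (at x)"
proof -
  consider "x > 0" | "x < 0" | "x = 0" by linarith
  then show ?thesis
  proof cases
    case 1
    then have "((\<lambda>x. x powr n) has_real_derivative n * max 0 x powr (n - 1)) (at x)"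
      by (auto intro!: derivative_eq_intros)
    then show ?thesis
      by (rule has_field_derivative_transform_within_open[where S="{0<..}"]) (use 1 in auto)
  next
    case 2
    then have "((\<lambda>x. 0) has_real_derivative n * max 0 x powr (n - 1)) (at x)"
      by simp
    then show ?thesis
      by (rule has_field_derivative_transform_within_open[where S="{..<0}"]) (use 2 in auto)
  next
    case 3
    have "((\<lambda>y. max 0 y powr n / y) \<longlongrightarrow> 0) (at 0)"
    proof (rule Lim_null_comparison)
      show "\<forall>\<^sub>F y in at 0. norm (max 0 y powr n / y) \<le> \<bar>y\<bar> powr (n - 1)"
      proof (rule always_eventually, rule allI)
        fix y :: real
        show "norm (max 0 y powr n / y) \<le> \<bar>y\<bar> powr (n - 1)"
        proof (cases "y > 0")
          case True
          then show ?thesis by (simp add: powr_diff)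
        next
          case False
          then show ?thesis by (simp add: max_absorb1)
        qed
      qed
      have "((\<lambda>y. \<bar>y\<bar> powr (n - 1)) \<longlongrightarrow> \<bar>0\<bar> powr (n - 1)) (at (0::real))"
        using assms by (intro tendsto_powr' tendsto_intros) auto
      then show "((\<lambda>y. \<bar>y\<bar> powr (n - 1)) \<longlongrightarrow> 0) (at (0::real))" by simp
    qed
    then show ?thesis
      using 3 by (simp add: has_field_derivative_iff)
  qed
qed

text \<open>Separation of variables: with \<open>m = (q + 1) / p < 1\<close> the power
  \<open>1 - m\<close> of \<open>u\<close> is affine until it reaches 0. Hence the exponent is
  \<open>n = 1 / (1 - m)\<close>, and \<open>R = n / k\<close> for the slope constant
  \<open>k\<close>.\<close>

lemma compactly_supported_profile:
  assumes "p > 1" "q \<ge> 0" "q < p - 1"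
  defines "R \<equiv> ((p - 1) powr (1 / p) * (q + 1) powr (1 / p)) / (p powr (1 / p - 1) * (p - q - 1))"
  shows "is_profile p q (\<lambda>r. max 0 (1 - r / R) powr (p / (p - q - 1)))"
proof -
  define n where "n = p / (p - q - 1)"
  have n: "n > 1" using assms by (simp add: n_def field_simps)
  have R: "R > 0" using assms(1-3) by (simp add: R_def)
  have k: "n / R = slope_const p q"
  proof -
    have "p * p powr (1 / p - 1) = p powr (1 / p)"
      using assms(1) powr_mult_base[of p "1 / p - 1"] by simp
    then show ?thesis
      using assms(1-3) by (simp add: n_def R_def slope_const_eq)
  qed
  have nm: "n * ((q + 1) / p) = n - 1"
  proof -
    have "n - 1 = (p - (p - q - 1)) / (p - q - 1)"
      unfolding n_def diff_divide_distrib[of p "p - q - 1"] using assms(1-3) by simp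
    also have "p - (p - q - 1) = q + 1" by simp
    finally show ?thesis using assms(1) by (simp only: n_def) simp
  qed
  define U where "U r = max 0 (1 - r / R) powr n" for r
  have d: "(U has_real_derivative - slope_const p q * U r powr ((q + 1) / p)) (at r)" for r
  proof -
    have "((\<lambda>r. 1 - r / R) has_real_derivative - 1 / R) (at r)"
      using R by (auto intro!: derivative_eq_intros)
    from DERIV_chain2[OF DERIV_max_0_powr[OF n] this]
    have "(U has_real_derivative n * max 0 (1 - r / R) powr (n - 1) * (- 1 / R)) (at r)"
      unfolding U_def .
    also have "n * max 0 (1 - r / R) powr (n - 1) * (- 1 / R) = - (n / R) * max 0 (1 - r / R) powr (n - 1)"
      by simp
    also have "\<dots> = - slope_const p q * U r powr ((q + 1) / p)"
      by (simp only: k U_def powr_powr nm)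
    finally show ?thesis .
  qed
  have "(U \<longlongrightarrow> U 0) (at_right 0)"
    using DERIV_isCont[OF d[of 0]] by (simp add: isCont_def filterlim_at_split)
  then have "(U \<longlongrightarrow> 1) (at_right 0)" by (simp add: U_def)
  moreover have "(U \<longlongrightarrow> 0) at_top"
  proof (rule tendsto_eventually)
    show "eventually (\<lambda>r. U r = 0) at_top"
      using eventually_ge_at_top[of R] by eventually_elim (use R in \<open>simp add: U_def max_def\<close>)
  qed
  ultimately have "is_profile p q U"
    unfolding is_profile_def using d by (simp add: U_def)
  then show ?thesis by (simp add: U_def[abs_def] n_def)
qed

text \<open>Now \<open>m = (q + 1) / p > 1\<close>, and the negative power \<open>1 - m\<close> of
  \<open>u\<close> is affine and increasing. Hence \<open>n = 1 / (m - 1)\<close> and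
  \<open>c = k / n\<close>, and 0 is reached only in the limit.\<close>

lemma algebraic_profile:
  assumes "p > 1" "q \<ge> 0" "q > p - 1"
  shows "is_profile p q (\<lambda>r. (1 + (p powr (1 / p - 1) * (q + 1 - p)) /
    ((p - 1) powr (1 / p) * (q + 1) powr (1 / p)) * r) powr (- p / (q + 1 - p)))"
proof -
  define n where "n = p / (q + 1 - p)"
  define c where "c = (p powr (1 / p - 1) * (q + 1 - p)) / ((p - 1) powr (1 / p) * (q + 1) powr (1 / p))"
  have n: "n > 0" using assms by (simp add: n_def)
  have c: "c > 0" using assms by (simp add: c_def)
  have k: "n * c = slope_const p q"
  proof -
    have "p * p powr (1 / p - 1) = p powr (1 / p)"
      using assms(1) powr_mult_base[of p "1 / p - 1"] by simp
    then show ?thesis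
      using assms by (simp add: n_def c_def slope_const_eq)
  qed
  have nm: "- n * ((q + 1) / p) = - n - 1"
  proof -
    have "n + 1 = (p + (q + 1 - p)) / (q + 1 - p)"
      unfolding n_def add_divide_distrib[of p "q + 1 - p"] using assms by simp
    also have "p + (q + 1 - p) = q + 1" by simp
    finally have "n + 1 = n * ((q + 1) / p)" using assms by (simp only: n_def) simp
    then show ?thesis by simp
  qed
  define U where "U r = (1 + c * r) powr (- n)" for r
  have d: "(U has_real_derivative - slope_const p q * U r powr ((q + 1) / p)) (at r)" if "r > 0" for r
  proof -
    have "1 + c * r > 0" using c that by (simp add: add_pos_pos)
    then have "(U has_real_derivative - n * (1 + c * r) powr (- n - 1) * c) (at r)"
      unfolding U_def by (intro DERIV_chain2[OF has_real_derivative_powr]) (auto intro!: derivative_eq_intros)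
    also have "- n * (1 + c * r) powr (- n - 1) * c = - (n * c) * (1 + c * r) powr (- n - 1)"
      by simp
    also have "\<dots> = - slope_const p q * U r powr ((q + 1) / p)"
      by (simp only: k U_def powr_powr nm)
    finally show ?thesis .
  qed
  have "(U \<longlongrightarrow> (1 + c * 0) powr (- n)) (at_right 0)"
    unfolding U_def by (intro tendsto_intros) auto
  moreover have "(U \<longlongrightarrow> 0) at_top"
    unfolding U_def using c n by real_asymp
  ultimately have "is_profile p q U"
    unfolding is_profile_def using d by (simp add: U_def)
  then show ?thesis by (simp add: U_def[abs_def] n_def c_def)
qed

lemma profile_exists:
  assumes "p > 1" "q \<ge> 0"
  obtains U where "is_profile p q U"
  using assms exp_profile compactly_supported_profile algebraic_profile
  by (metis linorder_neqE_linordered_idom)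

section \<open>Sharpness of the constant\<close>

lemma abs_le_of_AE_le:
  fixes u :: "real \<Rightarrow> real"
  assumes "continuous_on UNIV u" "AE x in lebesgue. \<bar>u x\<bar> \<le> B"
  shows "\<bar>u x\<bar> \<le> B"
proof (rule ccontr)
  assume "\<not> \<bar>u x\<bar> \<le> B"
  define A where "A = {x. B < \<bar>u x\<bar>}"
  have "open A"
    unfolding A_def by (intro open_Collect_less continuous_intros assms)
  moreover have "x \<in> A" using \<open>\<not> \<bar>u x\<bar> \<le> B\<close> by (simp add: A_def)
  then have "A \<noteq> {}" by blast
  ultimately have "\<not> negligible A" by (rule open_not_negligible)
  moreover have "negligible A"
    unfolding negligible_iff_null_sets
  proof (subst AE_iff_null_sets)
    show "A \<in> sets lebesgue" using \<open>open A\<close> by auto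
    show "AE x in lebesgue. x \<notin> A" using assms(2) by eventually_elim (simp add: A_def)
  qed
  ultimately show False by blast
qed

text \<open>For the even extension \<open>u\<close> the integral of
  \<open>h = u\<^sup>q\<^sup>+\<^sup>1\<close> is \<open>2 / (s * k)\<close>, and the gradient
  integral is \<open>k powr p\<close> times that. The norms then multiply to
  \<open>(2 / s) powr (1 / s)\<close>, while \<open>u 0 = 1\<close>.\<close>

lemma GN_constant_lower_bound:
  assumes pq: "p > 1" "q \<ge> 0" and C': "GN_inequality p q C'"
  shows "((p + (p - 1) * (q + 1)) / (2 * p)) powr (p / (p + (p - 1) * (q + 1))) \<le> C'"
proof -
  define s where "s = 1 + (q + 1) * (p - 1) / p"
  have s: "s > 1" using pq by (simp add: s_def)
  have sp: "s = (p + (p - 1) * (q + 1)) / p" using pq by (simp add: s_def field_simps)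
  have th: "GN_theta p q = 1 / s" "p / (p + (p - 1) * (q + 1)) = 1 / s"
    "(p + (p - 1) * (q + 1)) / (2 * p) = s / 2"
    using pq by (auto simp: GN_theta_def sp)
  define k where "k = slope_const p q"
  have k: "k > 0" using slope_const_pos[OF pq] by (simp add: k_def)
  define m where "m = (q + 1) / p"
  have m: "m > 0" "m * p = q + 1" using pq by (auto simp: m_def)
  have sm: "s - 1 + m = q + 1" using pq by (simp add: s_def m_def field_simps)
  obtain U where U: "is_profile p q U" using profile_exists[OF pq] .
  \<comment> \<open>A profile is constrained only at positive arguments; the value 1 elsewhere
    matches its right-hand limit and makes \<open>G\<close> continuous at 0.\<close>
  define G where "G r = (if r \<le> 0 then 1 else U r)" for r
  have G0: "G r \<ge> 0" for r using U by (auto simp: G_def is_profile_def)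
  have Gd: "(G has_real_derivative - k * G r powr m) (at r)" if "r > 0" for r
  proof -
    have "(U has_real_derivative - k * G r powr m) (at r)"
      using U that by (simp add: is_profile_def k_def m_def G_def)
    then show ?thesis
      by (rule has_field_derivative_transform_within_open[where S="{0<..}"]) (use that in \<open>auto simp: G_def\<close>)
  qed
  have Gc: "isCont G r" for r
  proof -
    consider "r > 0" | "r < 0" | "r = 0" by linarith
    then show ?thesis
    proof cases
      case 2
      then have "eventually (\<lambda>x. G x = 1) (nhds r)"
        using eventually_nhds_in_open[of "{..<0}" r] by (auto simp: G_def elim: eventually_mono)
      then show ?thesis using isCont_cong[of G "\<lambda>_. 1"] by simp
    next
      case 3
      have ev: "eventually (\<lambda>x. U x = G x) (at_right 0)" "eventually (\<lambda>x. 1 = G x) (at_left 0)"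
        by (auto simp: eventually_at_filter G_def)
      have "(G \<longlongrightarrow> 1) (at_right 0)" "(G \<longlongrightarrow> 1) (at_left 0)"
        using U tendsto_cong[OF ev(1), of 1] tendsto_cong[OF ev(2), of 1] by (auto simp: is_profile_def)
      then show ?thesis using 3 by (simp add: isCont_def filterlim_at_split G_def)
    qed (use Gd DERIV_isCont in blast)
  qed
  have Glim: "(G \<longlongrightarrow> 0) at_top"
  proof -
    have "eventually (\<lambda>r. U r = G r) at_top"
      by (auto simp: G_def intro: eventually_mono[OF eventually_gt_at_top[of 0]])
    then show ?thesis using U tendsto_cong[of U G at_top 0] by (simp add: is_profile_def)
  qed
  define u where "u x = G \<bar>x\<bar>" for x
  define v where "v x = - sgn x * (k * u x powr m)" for x
  have u0: "u 0 = 1" by (simp add: u_def G_def)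
  have unn: "u x \<ge> 0" for x by (simp add: u_def G0)
  have uc: "continuous_on A u" for A
    unfolding u_def
    by (rule continuous_on_compose2[of UNIV G]) (auto intro!: continuous_intros continuous_at_imp_continuous_on Gc)
  have upc: "continuous_on A (\<lambda>x. u x powr a)" if "a > 0" for a A
    by (intro continuous_on_powr' uc continuous_intros) (use unn that in auto)
  have abs_d: "((\<lambda>x. \<bar>x\<bar>) has_real_derivative sgn x) (at x)" if "x \<noteq> 0" for x :: real
  proof -
    have "((\<lambda>t. sgn x * t) has_real_derivative sgn x) (at x)"
      by (auto intro!: derivative_eq_intros)
    then show ?thesis
      by (rule has_field_derivative_transform_within_open[where S="if x > 0 then {0<..} else {..<0}"])
         (use that in \<open>auto simp: sgn_if split: if_splits\<close>)
  qed
  have ud: "(u has_real_derivative v x) (at x)" if "x \<noteq> 0" for x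
    using DERIV_chain2[OF Gd abs_d[OF that]] that by (simp add: u_def[abs_def] v_def mult_ac)
  have borel: "f \<in> borel_measurable lebesgue" if "f \<in> borel_measurable borel" for f :: "real \<Rightarrow> real"
    using that by (intro measurable_completion) simp
  have sgnm: "(sgn :: real \<Rightarrow> real) \<in> borel_measurable lebesgue"
    by (intro borel borel_measurable_sgn)
  have sgn_int: "set_integrable lebesgue {a..b} (sgn :: real \<Rightarrow> real)" for a b
  proof -
    have "(\<lambda>x. sgn x * 1) absolutely_integrable_on {a..b :: real}"
    proof (rule absolutely_integrable_bounded_measurable_product_real)
      show "(sgn :: real \<Rightarrow> real) \<in> borel_measurable (lebesgue_on {a..b})"
        by (rule measurable_restrict_space1[OF sgnm])
      show "bounded ((sgn :: real \<Rightarrow> real) ` {a..b})"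
        by (intro boundedI[where B=1]) (auto simp: sgn_if)
    qed auto
    then show ?thesis by simp
  qed
  have vi: "set_integrable lebesgue {a..b} v" for a b
  proof -
    have "set_integrable lebesgue {a..b} (\<lambda>x. - (k * u x powr m) * sgn x)"
      by (intro set_integrable_continuous_mult sgn_int continuous_intros upc m)
    then show ?thesis by (simp add: v_def[abs_def] mult.commute)
  qed
  have weak: "has_weak_derivative_on u v UNIV"
    by (intro has_weak_derivative_onI indefinite_integral_of_derivative[where N="{0}"] uc vi ud) auto
  define h where "h x = u x powr (q + 1)" for x
  have hc: "continuous_on A h" for A unfolding h_def using upc pq by simp
  txt \<open>\<open>P\<close> is the antiderivative of \<open>h\<close>: the first-order equation gives \<open>(u\<^sup>s)' = - s k u\<^sup>q\<^sup>+\<^sup>1\<close> for positive arguments.\<close>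
  define P where "P x = sgn x * (1 - u x powr s) / (s * k)" for x
  \<comment> \<open>The jump of \<open>sgn\<close> at 0 is cancelled by the factor
    \<open>1 - u x powr s\<close>, which tends to 0 there since \<open>u 0 = 1\<close>.\<close>
  have Pc: "continuous_on A P" for A
  proof -
    define w where "w x = u x powr s" for x
    have w: "isCont w x" for x
      using upc[of s UNIV] s by (simp add: w_def[abs_def] continuous_on_eq_continuous_at)
    have Pw: "P = (\<lambda>x. sgn x * (1 - w x) / (s * k))" by (simp add: P_def w_def fun_eq_iff)
    have "isCont P x" for x
    proof (cases "x = 0")
      case False
      then show ?thesis unfolding Pw using s k by (intro continuous_intros w) auto
    next
      case True
      have "((\<lambda>x. (1 - w x) / (s * k)) \<longlongrightarrow> (1 - w 0) / (s * k)) (at 0)"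
        using w[of 0] s k by (intro tendsto_intros) (auto simp: isCont_def)
      then have "((\<lambda>x. (1 - w x) / (s * k)) \<longlongrightarrow> 0) (at 0)" by (simp add: w_def u0)
      then have "(P \<longlongrightarrow> 0) (at 0)"
      proof (rule Lim_transform_bound[rotated])
        show "\<forall>\<^sub>F x in at 0. norm (P x) \<le> norm ((1 - w x) / (s * k))"
          by (rule always_eventually) (auto simp: Pw sgn_if abs_minus_commute)
      qed
      then show ?thesis using True by (simp add: isCont_def P_def)
    qed
    then show ?thesis by (simp add: continuous_at_imp_continuous_on)
  qed
  have Pd: "(P has_real_derivative h x) (at x)" if "x \<noteq> 0" for x
  proof -
    \<comment> \<open>The rule for \<open>max 0\<close> covers points where \<open>u\<close>
      vanishes, as happens for a compactly supported profile.\<close>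
    have "((\<lambda>t. u t powr s) has_real_derivative s * u x powr (s - 1) * v x) (at x)"
      using DERIV_chain2[OF DERIV_max_0_powr[OF s] ud[OF that]] by (simp add: unn max_absorb2)
    then have "((\<lambda>t. sgn x * (1 - u t powr s) / (s * k)) has_real_derivative
      sgn x * (0 - s * u x powr (s - 1) * v x) / (s * k)) (at x)"
      by (intro DERIV_cdivide DERIV_cmult DERIV_diff DERIV_const)
    also have "sgn x * (0 - s * u x powr (s - 1) * v x) / (s * k) = (sgn x * sgn x) * (u x powr (s - 1) * u x powr m)"
      using s k by (simp add: v_def)
    also have "\<dots> = h x"
      using that by (simp add: h_def sm sgn_if flip: powr_add)
    finally show ?thesis
    proof (rule has_field_derivative_transform_within_open)
      show "open (if x > 0 then {0<..} else {..<0::real})" by simp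
      show "x \<in> (if x > 0 then {0<..} else {..<0})" using that by simp
      show "sgn x * (1 - u t powr s) / (s * k) = P t" if "t \<in> (if x > 0 then {0<..} else {..<0})" for t
        using that \<open>x \<noteq> 0\<close> by (auto simp: P_def sgn_if split: if_splits)
    qed
  qed
  \<comment> \<open>Truncations of \<open>h\<close> to \<open>[- n, n]\<close>: \<open>P\<close>
    gives their integrals, and monotone convergence delivers integrability of \<open>h\<close>
    together with its integral.\<close>
  define f where "f n x = indicator {- real n..real n} x * h x" for n x
  have hi: "set_integrable lebesgue {a..b} h" for a b
    by (intro absolutely_integrable_continuous_real hc)
  have fint: "integrable lebesgue (f n)" for n
    using hi[of "- real n" "real n"] by (simp add: set_integrable_def f_def[abs_def])
  have fI: "(LINT x|lebesgue. f n x) = P (real n) - P (- real n)" for n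
  proof -
    have "(LINT x|lebesgue. f n x) = integral {- real n..real n} h"
      using set_lebesgue_integral_eq_integral(2)[OF hi[of "- real n" "real n"]]
      by (simp add: set_lebesgue_integral_def f_def)
    also have "\<dots> = P (real n) - P (- real n)"
      using indefinite_integral_ofD(2)[OF indefinite_integral_of_derivative[OF Pc _ _ hi, where N="{0}"],
          of "- real n" "real n" "- real n" "real n"] Pd by simp
    finally show ?thesis .
  qed
  have Plim: "(\<lambda>n. LINT x|lebesgue. f n x) \<longlonglongrightarrow> 2 / (s * k)"
  proof -
    have "(\<lambda>n. G (real n)) \<longlonglongrightarrow> 0"
      by (rule filterlim_compose[OF Glim filterlim_real_sequentially])
    then have "(\<lambda>n. 2 * (1 - G (real n) powr s) / (s * k)) \<longlonglongrightarrow> 2 * (1 - 0 powr s) / (s * k)"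
      using s k G0 by (intro tendsto_intros tendsto_powr') auto
    moreover have "eventually (\<lambda>n. 2 * (1 - G (real n) powr s) / (s * k) = (LINT x|lebesgue. f n x)) sequentially"
      using eventually_gt_at_top[of 0]
    proof eventually_elim
      case (elim n)
      define X where "X = (1 - G (real n) powr s) / (s * k)"
      have "P (real n) = X" "P (- real n) = - X"
        using elim by (simp_all add: P_def u_def X_def minus_divide_left)
      moreover have "2 * (1 - G (real n) powr s) / (s * k) = 2 * X" by (simp add: X_def)
      ultimately show ?case by (simp add: fI)
    qed
    ultimately show ?thesis using tendsto_cong by force
  qed
  have fmono: "AE x in lebesgue. mono (\<lambda>n. f n x)"
    by (intro AE_I2 monoI) (auto simp: f_def h_def indicator_def)
  have fnn: "AE x in lebesgue. 0 \<le> f n x" for n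
    by (intro AE_I2) (simp add: f_def h_def)
  have flim: "AE x in lebesgue. (\<lambda>n. f n x) \<longlonglongrightarrow> h x"
  proof (intro AE_I2 tendsto_eventually)
    fix x :: real
    show "eventually (\<lambda>n. f n x = h x) sequentially"
      using eventually_ge_at_top[of "nat \<lceil>\<bar>x\<bar>\<rceil>"]
      by eventually_elim (simp add: f_def indicator_def, linarith)
  qed
  have hm: "h \<in> borel_measurable lebesgue"
    by (intro borel borel_measurable_continuous_onI hc)
  have hint: "integrable lebesgue h" and hI: "(LINT x|lebesgue. h x) = 2 / (s * k)"
    using integral_monotone_convergence_nonneg[OF fint fmono fnn flim Plim hm] by auto
  have um: "u \<in> borel_measurable lebesgue"
    by (intro borel borel_measurable_continuous_onI uc)
  have vm: "v \<in> borel_measurable lebesgue"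
    unfolding v_def using um sgnm by measurable
  have vp: "AE x in lebesgue. k powr p * h x = \<bar>v x\<bar> powr p"
  proof -
    have "AE x in lebesgue. x \<notin> {0::real}"
      by (rule AE_not_in) (simp add: negligible_iff_null_sets[symmetric])
    then show ?thesis
    proof eventually_elim
      case (elim x)
      then have "\<bar>v x\<bar> = k * u x powr m"
        using k by (simp add: v_def abs_mult abs_sgn_eq)
      then show ?case using m by (simp add: powr_mult powr_powr h_def)
    qed
  qed
  have vint: "integrable lebesgue (\<lambda>x. \<bar>v x\<bar> powr p)"
    by (rule integrable_cong_AE_imp[OF integrable_mult_right[OF hint] _ vp]) (use vm in measurable)
  have vI: "(LINT x|lebesgue. \<bar>v x\<bar> powr p) = k powr p * (2 / (s * k))"
  proof -
    have "(LINT x|lebesgue. \<bar>v x\<bar> powr p) = (LINT x|lebesgue. k powr p * h x)"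
      by (rule integral_cong_AE[OF _ _ vp, symmetric]) (use vm hm in measurable)
    then show ?thesis by (simp add: hI)
  qed
  have "in_Lp (q + 1) u" "in_Lp p v"
    using um vm hint vint unn by (auto simp: in_Lp_def h_def[abs_def])
  then have Linf: "Linf_norm u \<le> ereal (C' * Lp_norm (q + 1) u powr (1 - 1 / s) * Lp_norm p v powr (1 / s))"
    using C' weak unfolding GN_inequality_def th by blast
  \<comment> \<open>The exponents of \<open>2 / (s * k)\<close> add up to \<open>1 / s\<close>
    because \<open>(p - 1) / p + 1 / p = 1\<close>; the remaining factor
    \<open>k powr (1 / s)\<close> cancels \<open>k\<close>.\<close>
  have norms: "Lp_norm (q + 1) u powr (1 - 1 / s) * Lp_norm p v powr (1 / s) = (2 / s) powr (1 / s)"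
  proof -
    have e: "(1 - 1 / s) / (q + 1) = (p - 1) / p * (1 / s)"
    proof -
      have "1 - 1 / s = (s - 1) / s" using s by (simp add: field_simps)
      then show ?thesis using pq by (simp add: s_def)
    qed
    have "Lp_norm (q + 1) u powr (1 - 1 / s) = (2 / (s * k)) powr ((p - 1) / p * (1 / s))"
      using hI unn e by (simp add: Lp_norm_def h_def powr_powr)
    moreover have "Lp_norm p v powr (1 / s) = (k powr p * (2 / (s * k))) powr (1 / p * (1 / s))"
      by (simp add: Lp_norm_def vI powr_powr)
    moreover have "(k powr p * (2 / (s * k))) powr (1 / p * (1 / s)) = k powr (1 / s) * (2 / (s * k)) powr (1 / p * (1 / s))"
      using pq by (simp only: powr_mult powr_powr) simp
    moreover have "(2 / (s * k)) powr ((p - 1) / p * (1 / s)) * (2 / (s * k)) powr (1 / p * (1 / s)) = (2 / (s * k)) powr (1 / s)"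
      unfolding powr_add[symmetric] using pq s by (simp add: field_simps)
    moreover have "(2 / (s * k)) powr (1 / s) * k powr (1 / s) = (2 / s) powr (1 / s)"
      unfolding powr_mult[symmetric] using k by simp
    ultimately show ?thesis by (simp add: mult_ac)
  qed
  have "AE x in lebesgue. ereal \<bar>u x\<bar> \<le> Linf_norm u"
    unfolding Linf_norm_def by (rule esssup_AE)
  then have "AE x in lebesgue. \<bar>u x\<bar> \<le> C' * (2 / s) powr (1 / s)"
  proof eventually_elim
    case (elim x)
    from order_trans[OF this Linf] show ?case by (simp add: norms mult.assoc)
  qed
  \<comment> \<open>The essential bound may be evaluated at the single point 0 because
    \<open>u\<close> is continuous.\<close>
  from abs_le_of_AE_le[OF uc this, of 0] have "1 \<le> C' * (2 / s) powr (1 / s)"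
    by (simp add: u0)
  then have "(s / 2) powr (1 / s) * 1 \<le> (s / 2) powr (1 / s) * (C' * (2 / s) powr (1 / s))"
    by (intro mult_left_mono) auto
  also have "\<dots> = C' * (s / 2 * (2 / s)) powr (1 / s)"
    by (simp only: powr_mult) simp
  also have "s / 2 * (2 / s) = 1" using s by simp
  finally show ?thesis unfolding th by simp
qed

theorem proposition4p2:
  fixes p q :: real
  assumes "p > 1" and "q \<ge> 0"
  shows "(q = p - 1 \<longrightarrow>
            (\<forall>u. is_solution p q u \<longleftrightarrow>
               (\<forall>r>0. u r = exp (- ((p - 1) powr (- 1 / p)) * r)))) \<and>
         (q < p - 1 \<longrightarrow>
            (let R = ((p - 1) powr (1 / p) * (q + 1) powr (1 / p)) /
                     (p powr (1 / p - 1) * (p - q - 1))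
             in \<forall>u. is_solution p q u \<longleftrightarrow>
                  (\<forall>r>0. u r = max 0 (1 - r / R) powr (p / (p - q - 1))))) \<and>
         (q > p - 1 \<longrightarrow>
            (\<forall>u. is_solution p q u \<longleftrightarrow>
               (\<forall>r>0. u r =
                  (1 + (p powr (1 / p - 1) * (q + 1 - p)) /
                       ((p - 1) powr (1 / p) * (q + 1) powr (1 / p)) * r)
                  powr (- p / (q + 1 - p))))) \<and>
         is_best_GN_constant p q
           (((p + (p - 1) * (q + 1)) / (2 * p)) powr (p / (p + (p - 1) * (q + 1))))"
  unfolding Let_def
proof (intro conjI impI allI)
  fix u
  show "is_solution p q u \<longleftrightarrow> (\<forall>r>0. u r = exp (- ((p - 1) powr (- 1 / p)) * r))" if "q = p - 1"
    by (rule solution_iff_eq_profile[OF assms exp_profile[OF assms(1) that]])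
  show "is_solution p q u \<longleftrightarrow> (\<forall>r>0. u r = max 0 (1 - r / (((p - 1) powr (1 / p) * (q + 1) powr (1 / p)) /
      (p powr (1 / p - 1) * (p - q - 1)))) powr (p / (p - q - 1)))" if "q < p - 1"
    by (rule solution_iff_eq_profile[OF assms compactly_supported_profile[OF assms that]])
  show "is_solution p q u \<longleftrightarrow> (\<forall>r>0. u r = (1 + (p powr (1 / p - 1) * (q + 1 - p)) /
      ((p - 1) powr (1 / p) * (q + 1) powr (1 / p)) * r) powr (- p / (q + 1 - p)))" if "q > p - 1"
    by (rule solution_iff_eq_profile[OF assms algebraic_profile[OF assms that]])
  show "is_best_GN_constant p q
      (((p + (p - 1) * (q + 1)) / (2 * p)) powr (p / (p + (p - 1) * (q + 1))))"
    unfolding is_best_GN_constant_def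
    using GN_inequality_holds[OF assms] GN_constant_lower_bound[OF assms] by blast
qed

end
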